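(* Let $r=0$, $q=1$, $g_h \in \Sigma_{h+}$, $\sigma_h \in \Sigma_h$, and $i \in \{1,2,\dots,N_0\}$. Let $\omega_i$ be the set of triangles in $\mathcal{T}_h$ having $y^{(i)}$ as a vertex. For each $K \in \omega_i$ and $t$ sufficiently small, let $\theta_{iK}(t)$ be the interior angle of $K$ at vertex $i$ as measured by $g_h + t \sigma_h$. Then $$\left.\frac{d}{dt}\right|_{t=0} \Big( 2\pi - \sum_{K \in \omega_i} \theta_{iK}(t) \Big) = \frac{1}{2} b_h(g_h; \sigma_h, \phi_i).$$
   Context: Setting. $\Omega\subset\mathbb{R}^2$ is a polygonal domain, $\mathbb{S}=\{\sigma\in\mathbb{R}^{2\times2}\mid\sigma=\sigma^T\}$, and $\mathcal{T}_h$ is a triangulation of $\Omega$. $\mathcal{E}_h$ is the set of edges of $\mathcal{T}_h$ and $\mathring{\mathcal{E}}_h$ the set of edges not contained in $\partial\Omega$. The vertices of $\mathcal{T}_h$ are $\{y^{(i)}\}_{i=1}^N$, enumerated so that $y^{(i)}\notin\partial\Omega$ if and only if $1\le i\le N_0<N$. Spaces. $V=\{v\in H^1_0(\Omega)\mid v|_K\in H^2(K)\ \forall K\in\mathcal{T}_h\}$. $\Sigma$ is the set of $\sigma\in L^2(\Omega)\otimes\mathbb{S}$ with $\sigma|_K\in H^1(K)\otimes\mathbb{S}$ for all $K\in\mathcal{T}_h$ and $\tau^T\sigma\tau$ continuous across every $e\in\mathring{\mathcal{E}}_h$ ($\tau$ a Euclidean unit tangent to $e$). $V_h=\{v\in V\mid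 v|_K\in\mathcal{P}_q(K)\ \forall K\}$ and $\Sigma_h=\{\sigma\in\Sigma\mid\sigma|_K\in\mathcal{P}_r(K)\otimes\mathbb{S}\ \forall K\}$, where $\mathcal{P}_j(K)$ denotes polynomials of degree $\le j$. $\Sigma_{h+}=\{\sigma\in\Sigma_h\mid\sigma(x)\succ0\ \forall x\in\mathring{K},\ \forall K\in\mathcal{T}_h\}$. For $q=1$, $\{\phi_i\}_{i=1}^{N_0}$ is the basis of $V_h$ with $\phi_i(y^{(j)})=1$ if $i=j$ and $0$ if $i\ne j$, $j=1,\dots,N$. The form $b_h$. Let $g$ be a metric (possibly discontinuous across edges, in which case all quantities are computed elementwise, using traces from the element under consideration). On an edge of $K$ let $n$ be the Euclidean outward unit normal, $J=\begin{pmatrix}0&1\\-1&0\end{pmatrix}$, $\tau=-Jn$, $\tau_g=\tau/\sqrt{\tau^Tg\tau}$, $n_g=Jg\tau/(\sqrt{\tau^Tg\tau}\sqrt{\det g})$. Put $S_g\sigma=\sigma-g\operatorname{Tr}(g^{-1}\sigma)$, $(\operatorname{Hess}_gv)_{ij}=\partial_i\partial_jv-\Gamma^k_{ij}\partial_kv$ with $\Gamma^k_{ij}=\frac12 g^{k\ell}(\partial_j g_{\ell i}+\partial_i g_{\ell j}-\partial_\ell g_{ij})$, $\nabla_gv=g^{-1}\nabla v$, $\frac{\partial v}{\partial n_g}=n_g^Tg\nabla_gv$. For an edge $e=K_1\cap K_2\in\mathring{\mathcal{E}}_h$, $\llbracket w\rrbracket=w|_{\partial K_1}+w|_{\partial K_2}$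 (each term using the outward normal of its own triangle); for $e\subset\partial\Omega$, $\llbracket w\rrbracket=w|_{\partial\Omega}$. Then for $\sigma\in\Sigma$, $v\in V$, $$b_h(g;\sigma,v)=\sum_{K\in\mathcal{T}_h}\langle S_g\sigma,\operatorname{Hess}_gv\rangle_{g,K}+\sum_{e\in\mathcal{E}_h}\Big\langle\tau_g^T\sigma\tau_g,\Big\llbracket\frac{\partial v}{\partial n_g}\Big\rrbracket\Big\rangle_{g,e},$$ where $\langle\sigma,\rho\rangle_{g,K}=\int_K\operatorname{Tr}(g^{-1}\sigma g^{-1}\rho)\sqrt{\det g}\,dx$ and $\langle u,w\rangle_{g,e}=\int_e uw\sqrt{\tau^Tg\tau}\,d\ell$. Angles. If $u,w\in\mathbb{R}^2$ are the edge vectors of $K$ emanating from $y^{(i)}$ and $A\succ0$ is the constant value on $K$ of a piecewise constant metric, the angle of $K$ at vertex $i$ measured by that metric is $\arccos\big(u^TAw/(\sqrt{u^TAu}\sqrt{w^TAw})\big)\in(0,\pi)$. *)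

theory Defs
  imports "HOL-Analysis.Analysis"
begin

type_synonym pt = "real^2"
type_synonym mat2 = "real^2^2"

section \<open>Domain and triangulation\<close>

(* The condition interior (closure Omega) = Omega excludes slit domains, on which an
   edge contained in the boundary could be shared by two triangles. *)
definition polygonal_domain :: "pt set \<Rightarrow> bool" where
  "polygonal_domain \<Omega> \<longleftrightarrow>
     open \<Omega> \<and> connected \<Omega> \<and> bounded \<Omega> \<and> \<Omega> \<noteq> {} \<and> interior (closure \<Omega>) = \<Omega> \<and>
     (\<exists>S. finite S \<and> (\<forall>s\<in>S. \<exists>a b. s = closed_segment a b) \<and> frontier \<Omega> = \<Union>S)"

(* Triangles are closed; the library's triangulation demands that any two of them
   meet in a common face. *)
definition triangulation_of :: "pt set \<Rightarrow> pt set set \<Rightarrow> bool" where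
  "triangulation_of \<Omega> \<T> \<longleftrightarrow>
     triangulation \<T> \<and> (\<forall>K\<in>\<T>. 2 simplex K) \<and> \<Union>\<T> = closure \<Omega>"

definition edges :: "pt set set \<Rightarrow> pt set set" where
  "edges \<T> = {e. \<exists>K\<in>\<T>. e edge_of K}"

definition interior_edges :: "pt set \<Rightarrow> pt set set \<Rightarrow> pt set set" where
  "interior_edges \<Omega> \<T> = {e \<in> edges \<T>. \<not> e \<subseteq> frontier \<Omega>}"

definition vertices :: "pt set set \<Rightarrow> pt set" where
  "vertices \<T> = {p. \<exists>K\<in>\<T>. p extreme_point_of K}"

definition vertex_patch :: "pt set set \<Rightarrow> pt \<Rightarrow> pt set set" where
  "vertex_patch \<T> p = {K \<in> \<T>. p extreme_point_of K}"


section \<open>Sobolev spaces\<close>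

text \<open>
  Functions are honest functions on the plane; only their values on the set under
  consideration matter. Weak derivatives are taken against continuously differentiable,
  compactly supported test functions, and \<open>H1_0\<close> is the closure of these in the
  \<open>H1\<close> norm, as in Gilbarg and Trudinger (Chapter 7). By mollification, infinitely
  differentiable test functions give the same notions.
\<close>

definition partial :: "2 \<Rightarrow> (pt \<Rightarrow> real) \<Rightarrow> pt \<Rightarrow> real" where
  "partial i f x = frechet_derivative f (at x) (axis i 1)"

definition test_function :: "pt set \<Rightarrow> (pt \<Rightarrow> real) \<Rightarrow> bool" where
  "test_function U \<psi> \<longleftrightarrow>
     (\<forall>x. \<psi> differentiable (at x)) \<and> (\<forall>i. continuous_on UNIV (partial i \<psi>)) \<and>
     (\<exists>C. compact C \<and> C \<subseteq> U \<and> (\<forall>x. x \<notin> C \<longrightarrow> \<psi> x = 0))"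

definition locally_integrable :: "pt set \<Rightarrow> (pt \<Rightarrow> real) \<Rightarrow> bool" where
  "locally_integrable U u \<longleftrightarrow> (\<forall>C. compact C \<and> C \<subseteq> U \<longrightarrow> set_integrable lebesgue C u)"

definition has_weak_partial :: "pt set \<Rightarrow> 2 \<Rightarrow> (pt \<Rightarrow> real) \<Rightarrow> (pt \<Rightarrow> real) \<Rightarrow> bool" where
  "has_weak_partial U i u w \<longleftrightarrow>
     locally_integrable U u \<and> locally_integrable U w \<and>
     (\<forall>\<psi>. test_function U \<psi> \<longrightarrow>
        (LINT x:U|lebesgue. u x * partial i \<psi> x) = - (LINT x:U|lebesgue. w x * \<psi> x))"

(* Determined up to a null set whenever a weak derivative exists; everything below is
   insensitive to the choice. *)
definition weak_partial :: "pt set \<Rightarrow> 2 \<Rightarrow> (pt \<Rightarrow> real) \<Rightarrow> pt \<Rightarrow> real" where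
  "weak_partial U i u = (SOME w. has_weak_partial U i u w)"

definition L2 :: "pt set \<Rightarrow> (pt \<Rightarrow> real) set" where
  "L2 U = {u. u \<in> borel_measurable (lebesgue_on U) \<and> integrable (lebesgue_on U) (\<lambda>x. (u x)\<^sup>2)}"

definition H1 :: "pt set \<Rightarrow> (pt \<Rightarrow> real) set" where
  "H1 U = {u \<in> L2 U. \<forall>i. \<exists>w \<in> L2 U. has_weak_partial U i u w}"

definition H2 :: "pt set \<Rightarrow> (pt \<Rightarrow> real) set" where
  "H2 U = {u \<in> L2 U. \<forall>i. \<exists>w \<in> H1 U. has_weak_partial U i u w}"

definition H1_0 :: "pt set \<Rightarrow> (pt \<Rightarrow> real) set" where
  "H1_0 U = {u \<in> H1 U. \<exists>\<psi> :: nat \<Rightarrow> pt \<Rightarrow> real.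
     (\<forall>n. test_function U (\<psi> n)) \<and>
     (\<lambda>n. LINT x:U|lebesgue. (\<psi> n x - u x)\<^sup>2) \<longlonglongrightarrow> 0 \<and>
     (\<forall>i. (\<lambda>n. LINT x:U|lebesgue. (partial i (\<psi> n) x - weak_partial U i u x)\<^sup>2) \<longlonglongrightarrow> 0)}"

(* Trace from inside K at a boundary point: the limit of the averages over small half-balls
   or sectors, which equals the Sobolev trace of an H1 field at almost every point of the
   boundary of K. *)
definition boundary_trace :: "pt set \<Rightarrow> (pt \<Rightarrow> 'a::euclidean_space) \<Rightarrow> pt \<Rightarrow> 'a" where
  "boundary_trace K f x = Lim (at_right 0)
     (\<lambda>r. (1 / measure lebesgue (interior K \<inter> ball x r)) *\<^sub>R
           (LINT z:(interior K \<inter> ball x r)|lebesgue. f z))"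


section \<open>The spaces\<close>

definition Sym :: "mat2 set" where
  "Sym = {A. transpose A = A}"

definition pos_def :: "mat2 \<Rightarrow> bool" where
  "pos_def A \<longleftrightarrow> A \<in> Sym \<and> (\<forall>u. u \<noteq> 0 \<longrightarrow> 0 < u \<bullet> (A *v u))"

definition polys :: "nat \<Rightarrow> (pt \<Rightarrow> real) set" where
  "polys q = {p. \<exists>c. p = (\<lambda>x. \<Sum>a\<le>q. \<Sum>b\<le>q - a. c a b * (x $ 1) ^ a * (x $ 2) ^ b)}"

definition V :: "pt set \<Rightarrow> pt set set \<Rightarrow> (pt \<Rightarrow> real) set" where
  "V \<Omega> \<T> = {v \<in> H1_0 \<Omega>. \<forall>K\<in>\<T>. v \<in> H2 (interior K)}"

(* Agreement with a polynomial on the closed triangles selects the continuous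
   representative, so that nodal values make sense. *)
definition V_h :: "nat \<Rightarrow> pt set \<Rightarrow> pt set set \<Rightarrow> (pt \<Rightarrow> real) set" where
  "V_h q \<Omega> \<T> = {v \<in> V \<Omega> \<T>. \<forall>K\<in>\<T>. \<exists>p\<in>polys q. \<forall>x\<in>K. v x = p x}"

definition tangentially_continuous :: "pt set \<Rightarrow> pt set set \<Rightarrow> (pt \<Rightarrow> mat2) \<Rightarrow> bool" where
  "tangentially_continuous \<Omega> \<T> \<sigma> \<longleftrightarrow>
     (\<forall>e\<in>interior_edges \<Omega> \<T>. \<forall>K1\<in>\<T>. \<forall>K2\<in>\<T>. \<forall>a b.
        e edge_of K1 \<and> e edge_of K2 \<and> e = closed_segment a b \<longrightarrow>
        (let \<tau> = (1 / norm (b - a)) *\<^sub>R (b - a) in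
          AE t in lebesgue_on {0..1}. (let x = a + t *\<^sub>R (b - a) in
            \<tau> \<bullet> (boundary_trace K1 \<sigma> x *v \<tau>) = \<tau> \<bullet> (boundary_trace K2 \<sigma> x *v \<tau>))))"

definition Sigma_space :: "pt set \<Rightarrow> pt set set \<Rightarrow> (pt \<Rightarrow> mat2) set" where
  "Sigma_space \<Omega> \<T> = {\<sigma>.
     (AE x in lebesgue_on \<Omega>. \<sigma> x \<in> Sym) \<and>
     (\<forall>i j. (\<lambda>x. \<sigma> x $ i $ j) \<in> L2 \<Omega>) \<and>
     (\<forall>K\<in>\<T>. \<forall>i j. (\<lambda>x. \<sigma> x $ i $ j) \<in> H1 (interior K)) \<and>
     tangentially_continuous \<Omega> \<T> \<sigma>}"

definition Sigma_h :: "nat \<Rightarrow> pt set \<Rightarrow> pt set set \<Rightarrow> (pt \<Rightarrow> mat2) set" where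
  "Sigma_h r \<Omega> \<T> = {\<sigma> \<in> Sigma_space \<Omega> \<T>. \<forall>K\<in>\<T>.
     (\<forall>x\<in>interior K. \<sigma> x \<in> Sym) \<and>
     (\<forall>i j. \<exists>p\<in>polys r. \<forall>x\<in>interior K. \<sigma> x $ i $ j = p x)}"

definition Sigma_h_plus :: "nat \<Rightarrow> pt set \<Rightarrow> pt set set \<Rightarrow> (pt \<Rightarrow> mat2) set" where
  "Sigma_h_plus r \<Omega> \<T> = {\<sigma> \<in> Sigma_h r \<Omega> \<T>. \<forall>K\<in>\<T>. \<forall>x\<in>interior K. pos_def (\<sigma> x)}"


section \<open>Geometry of the metric on a triangle\<close>

definition S_op :: "mat2 \<Rightarrow> mat2 \<Rightarrow> mat2" where
  "S_op g s = s - trace (matrix_inv g ** s) *\<^sub>R g"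

definition christoffel :: "pt set \<Rightarrow> (pt \<Rightarrow> mat2) \<Rightarrow> 2 \<Rightarrow> 2 \<Rightarrow> 2 \<Rightarrow> pt \<Rightarrow> real" where
  "christoffel U g k i j x = 1 / 2 * (\<Sum>l\<in>UNIV. matrix_inv (g x) $ k $ l *
      (weak_partial U j (\<lambda>z. g z $ l $ i) x
       + weak_partial U i (\<lambda>z. g z $ l $ j) x
       - weak_partial U l (\<lambda>z. g z $ i $ j) x))"

definition hess :: "pt set \<Rightarrow> (pt \<Rightarrow> mat2) \<Rightarrow> (pt \<Rightarrow> real) \<Rightarrow> pt \<Rightarrow> mat2" where
  "hess U g v x = (\<chi> i j. weak_partial U i (weak_partial U j v) x
      - (\<Sum>k\<in>UNIV. christoffel U g k i j x * weak_partial U k v x))"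

definition inner_K :: "(pt \<Rightarrow> mat2) \<Rightarrow> pt set \<Rightarrow> (pt \<Rightarrow> mat2) \<Rightarrow> (pt \<Rightarrow> mat2) \<Rightarrow> real" where
  "inner_K g K \<sigma> \<rho> = (LINT x:interior K|lebesgue.
      trace (matrix_inv (g x) ** \<sigma> x ** matrix_inv (g x) ** \<rho> x) * sqrt (det (g x)))"

definition J :: mat2 where
  "J = vector [vector [0, 1], vector [-1, 0]]"

definition outward_normal :: "pt set \<Rightarrow> pt set \<Rightarrow> pt" where
  "outward_normal K e = (THE n. norm n = 1 \<and>
      (\<forall>x\<in>e. \<forall>z\<in>e. n \<bullet> (z - x) = 0) \<and> (\<forall>x\<in>e. \<forall>z\<in>K. n \<bullet> (z - x) \<le> 0))"

definition tangent :: "pt set \<Rightarrow> pt set \<Rightarrow> pt" where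
  "tangent K e = - (J *v outward_normal K e)"

definition g_tangent :: "mat2 \<Rightarrow> pt \<Rightarrow> pt" where
  "g_tangent A \<tau> = (1 / sqrt (\<tau> \<bullet> (A *v \<tau>))) *\<^sub>R \<tau>"

definition g_normal :: "mat2 \<Rightarrow> pt \<Rightarrow> pt" where
  "g_normal A \<tau> = (1 / (sqrt (\<tau> \<bullet> (A *v \<tau>)) * sqrt (det A))) *\<^sub>R (J *v (A *v \<tau>))"

(* The next three are traces on the edge e taken from the triangle K. *)
definition normal_deriv ::
    "(pt \<Rightarrow> mat2) \<Rightarrow> (pt \<Rightarrow> real) \<Rightarrow> pt set \<Rightarrow> pt set \<Rightarrow> pt \<Rightarrow> real" where
  "normal_deriv g v K e x =
     (let A = boundary_trace K g x;
          grad = boundary_trace K (\<lambda>z. \<chi> k. weak_partial (interior K) k v z) x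
      in g_normal A (tangent K e) \<bullet> (A *v (matrix_inv A *v grad)))"

definition tangential_comp ::
    "(pt \<Rightarrow> mat2) \<Rightarrow> (pt \<Rightarrow> mat2) \<Rightarrow> pt set \<Rightarrow> pt set \<Rightarrow> pt \<Rightarrow> real" where
  "tangential_comp g \<sigma> K e x =
     (let \<tau>g = g_tangent (boundary_trace K g x) (tangent K e)
      in \<tau>g \<bullet> (boundary_trace K \<sigma> x *v \<tau>g))"

definition length_density :: "(pt \<Rightarrow> mat2) \<Rightarrow> pt set \<Rightarrow> pt set \<Rightarrow> pt \<Rightarrow> real" where
  "length_density g K e x = sqrt (tangent K e \<bullet> (boundary_trace K g x *v tangent K e))"


section \<open>The form\<close>

(* Common value of traces that agree from all triangles having e as an edge; used for the
   length density and the tangential component, which are single-valued on e because g and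
   sigma are tangentially continuous. *)
definition single_value ::
    "pt set set \<Rightarrow> (pt set \<Rightarrow> pt set \<Rightarrow> pt \<Rightarrow> real) \<Rightarrow> pt set \<Rightarrow> pt \<Rightarrow> real" where
  "single_value \<T> w e x = (THE s. \<forall>K\<in>\<T>. e edge_of K \<longrightarrow> w K e x = s)"

(* Two summands on an interior edge, one on a boundary edge. *)
definition jump ::
    "pt set set \<Rightarrow> (pt set \<Rightarrow> pt set \<Rightarrow> pt \<Rightarrow> real) \<Rightarrow> pt set \<Rightarrow> pt \<Rightarrow> real" where
  "jump \<T> w e x = (\<Sum>K\<in>{K\<in>\<T>. e edge_of K}. w K e x)"

(* Integral over a segment with respect to Euclidean arc length. *)
definition edge_integral :: "pt set \<Rightarrow> (pt \<Rightarrow> real) \<Rightarrow> real" where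
  "edge_integral e f = (let (a, b) = (SOME (a, b). e = closed_segment a b) in
      dist a b * (LINT t:{0..1}|lebesgue. f (a + t *\<^sub>R (b - a))))"

definition b_h ::
    "pt set set \<Rightarrow> (pt \<Rightarrow> mat2) \<Rightarrow> (pt \<Rightarrow> mat2) \<Rightarrow> (pt \<Rightarrow> real) \<Rightarrow> real" where
  "b_h \<T> g \<sigma> v =
     (\<Sum>K\<in>\<T>. inner_K g K (\<lambda>x. S_op (g x) (\<sigma> x)) (hess (interior K) g v)) +
     (\<Sum>e\<in>edges \<T>. edge_integral e (\<lambda>x.
        single_value \<T> (tangential_comp g \<sigma>) e x * jump \<T> (normal_deriv g v) e x *
        single_value \<T> (length_density g) e x))"


section \<open>Angles\<close>

definition const_value :: "pt set \<Rightarrow> (pt \<Rightarrow> mat2) \<Rightarrow> mat2" where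
  "const_value K g = (THE A. \<forall>x\<in>interior K. g x = A)"

(* Interior angle of K at its vertex p. The other two vertices a, b are determined up to
   order, and the value is symmetric in them for symmetric matrices. *)
definition metric_angle :: "(pt \<Rightarrow> mat2) \<Rightarrow> pt set \<Rightarrow> pt \<Rightarrow> real" where
  "metric_angle g K p = (THE \<theta>. \<exists>a b. {q. q extreme_point_of K} = {p, a, b} \<and>
     card {p, a, b} = 3 \<and>
     (let A = const_value K g; u = a - p; w = b - p in
      \<theta> = arccos ((u \<bullet> (A *v w)) / (sqrt (u \<bullet> (A *v u)) * sqrt (w \<bullet> (A *v w))))))"

end

theory Submission
  imports Defs
begin

text \<open>
  A piecewise constant metric and a piecewise linear function have vanishing Hessian on each
  triangle, so only the edge terms of the form survive. The tangential component and the length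
  density are single-valued on every edge, so the sum over edges of jumps can be regrouped into a
  sum over triangles of local contributions of their three edges. On a triangle with edge vectors
  \<open>u\<close>, \<open>w\<close> emanating from \<open>p\<close>, the gradient of the hat function is \<open>J (u - w) / (u \<times> w)\<close>, and the local
  contribution equals minus twice the derivative of the angle, because
  \<open>(u\<^sup>T A u) (w\<^sup>T A w) - (u\<^sup>T A w)\<^sup>2 = det A (u \<times> w)\<^sup>2\<close>. Triangles without the vertex \<open>p\<close> contribute
  nothing, since the hat function vanishes there.
\<close>

section \<open>Weak derivatives of affine functions\<close>

text \<open>The obstacle is that several notions are bare choices. \<open>weak_partial\<close>
  selects some weak derivative, so nothing can be said about the gradient of an affine function
  before weak derivatives are known to be unique almost everywhere; that is the fundamental lemma of
  the calculus of variations, needed here for continuously differentiable test functions. The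
  Hessian differentiates a gradient that is itself known only almost everywhere, so the facts on
  affine functions are stated for functions that are affine off a null set. Traces, being limits of
  averages, do not see null sets. \<open>outward_normal\<close>, \<open>single_value\<close> and
  \<open>metric_angle\<close> are definite descriptions, and each requires a uniqueness argument.
  Signs are fixed by listing the vertices of a triangle counterclockwise: the tangent of the
  definition then follows that order. The term of an edge is homogeneous of degree one in the
  tangent, so multiplication by the edge length replaces the unit tangent by the edge vector; this
  makes the sum over the three edges an algebraic expression in \<open>u\<close> and
  \<open>w\<close>.\<close>

lemma integrable_zero_on_boxes_imp_AE_zero:
  fixes f :: "'a::euclidean_space \<Rightarrow> real"
  assumes f: "integrable lborel f" and total: "(LINT x|lborel. f x) = 0"
    and box: "\<And>a b. (LINT x:box a b|lborel. f x) = 0"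
  shows "AE x in lborel. f x = 0"
proof (rule sigma_finite_measure.density_zero[OF sigma_finite_lborel f])
  have int: "set_integrable lborel A f" if "A \<in> sets lborel" for A
    unfolding set_integrable_def using that f by (rule integrable_mult_indicator)
  fix A :: "'a set" assume "A \<in> sets lborel"
  then have A: "A \<in> sigma_sets UNIV (range (\<lambda>(a, b). box a b))"
    by (simp add: borel_eq_box)
  \<comment> \<open>Dynkin's argument: the sets over which \<open>f\<close> integrates to 0 form a
    Dynkin system, and boxes are an intersection-stable generator of the Borel sets. The complement
    case subtracts from the integral over the whole space, which is why \<open>total\<close> is
    assumed.\<close>
  have "Int_stable (range (\<lambda>(a, b). box a b :: 'a set))"
    by (auto simp: Int_stable_def box_Int_box)
  moreover have "range (\<lambda>(a, b). box a b :: 'a set) \<subseteq> Pow UNIV" by simp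
  ultimately show "(LINT x:A|lborel. f x) = 0"
  using A proof (induct rule: sigma_sets_induct_disjoint)
    case (basic A) then show ?case using box by auto
  next
    case empty then show ?case by (simp add: set_lebesgue_integral_def)
  next
    case (compl A)
    then have A: "A \<in> sets lborel" by (simp add: borel_eq_box)
    have "(LINT x:UNIV - A|lborel. f x) = (LINT x|lborel. f x - indicator A x *\<^sub>R f x)"
      unfolding set_lebesgue_integral_def
      by (rule Bochner_Integration.integral_cong) (auto simp: indicator_def)
    also have "\<dots> = (LINT x|lborel. f x) - (LINT x:A|lborel. f x)"
      unfolding set_lebesgue_integral_def
      by (rule Bochner_Integration.integral_diff[OF f int[OF A, unfolded set_integrable_def]])
    finally show ?case using compl total by simp
  next
    case (union A)
    then have A: "A i \<in> sets lborel" for i by (auto simp: borel_eq_box)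
    then have U: "(\<Union>i. A i) \<in> sets lborel" by auto
    have "(LINT x:(\<Union>i. A i)|lborel. f x) = (\<Sum>i. (LINT x:A i|lborel. f x))"
      using union A int[OF U]
      by (intro lebesgue_integral_countable_add)
         (auto simp: disjoint_family_on_def)
    then show ?case using union by simp
  qed
qed

text \<open>A Lebesgue measurable function agrees almost everywhere with a Borel one, and this
  replacement leaves all box integrals unchanged.\<close>

lemma integrable_lebesgue_zero_on_boxes_imp_AE_zero:
  fixes f :: "'a::euclidean_space \<Rightarrow> real"
  assumes f: "integrable lebesgue f" and total: "(LINT x|lebesgue. f x) = 0"
    and box: "\<And>a b. (LINT x:box a b|lebesgue. f x) = 0"
  shows "AE x in lebesgue. f x = 0"
proof -
  obtain f' where f': "f' \<in> borel_measurable lborel" "AE x in lborel. f x = f' x"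
    using completion_ex_borel_measurable_real[OF borel_measurable_integrable[OF f]] by auto
  have f'2: "f' \<in> borel_measurable lebesgue" using f'(1) by (rule measurable_completion)
  have ae: "AE x in lebesgue. f x = f' x" using f'(2) by (rule AE_completion)
  have eq: "(LINT x:A|lborel. f' x) = (LINT x:A|lebesgue. f x)" if "A \<in> sets borel" for A
  proof -
    have "(LINT x:A|lborel. f' x) = (LINT x:A|lebesgue. f' x)"
      using f'(1) that unfolding set_lebesgue_integral_def by (intro integral_completion[symmetric]) auto
    also have "\<dots> = (LINT x:A|lebesgue. f x)"
      using f'2 f that ae by (intro set_lebesgue_integral_cong_AE) auto
    finally show ?thesis .
  qed
  have "integrable lebesgue f'"
    by (rule integrable_cong_AE_imp[OF f f'2]) (use ae in \<open>eventually_elim, simp\<close>)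
  then have i: "integrable lborel f'" using f'(1) by (simp add: integrable_completion)
  have "AE x in lborel. f' x = 0"
  proof (rule integrable_zero_on_boxes_imp_AE_zero[OF i])
    show "(LINT x|lborel. f' x) = 0"
      using eq[of UNIV] total by (simp add: set_lebesgue_integral_def)
    show "(LINT x:box a b|lborel. f' x) = 0" for a b
      using eq[of "box a b"] box by simp
  qed
  from AE_completion[OF this] ae show ?thesis by eventually_elim simp
qed

section \<open>Bump functions and the fundamental lemma of the calculus of variations\<close>

lemma partial_eqI: "(f has_derivative f') (at x) \<Longrightarrow> partial i f x = f' (axis i 1)"
  unfolding partial_def by (metis frechet_derivative_at)

text \<open>Squaring removes the kink of the positive part at 0. The result is a cutoff with a
  continuous derivative, which is all the regularity that test functions require.\<close>

lemma has_real_derivative_pos_part_square: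
  "((\<lambda>s. (max 0 s)\<^sup>2) has_real_derivative 2 * max 0 s) (at s)"
proof (cases "s = 0")
  case True
  have "((\<lambda>h. (max 0 h)\<^sup>2 / h) \<longlongrightarrow> 0) (at (0::real))"
  proof (rule Lim_null_comparison)
    show "\<forall>\<^sub>F h in at (0::real). norm ((max 0 h)\<^sup>2 / h) \<le> \<bar>h\<bar>"
      by (rule always_eventually) (auto simp: max_def power2_eq_square)
    show "((\<lambda>h. \<bar>h\<bar>) \<longlongrightarrow> 0) (at (0::real))" by (rule tendsto_rabs_zero) auto
  qed
  then show ?thesis using True by (simp add: DERIV_def)
next
  case False
  then consider "s > 0" | "s < 0" by linarith
  then show ?thesis
  proof cases
    case 1
    have "((\<lambda>s. s\<^sup>2) has_real_derivative 2 * max 0 s) (at s)"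
      using 1 by (auto intro!: derivative_eq_intros)
    then show ?thesis
      by (rule has_field_derivative_transform_within_open[of _ _ _ "{0<..}"]) (use 1 in auto)
  next
    case 2
    have "((\<lambda>s. 0) has_real_derivative 2 * max 0 s) (at s)"
      using 2 by (auto intro!: derivative_eq_intros)
    then show ?thesis
      by (rule has_field_derivative_transform_within_open[of _ _ _ "{..<0}"]) (use 2 in auto)
  qed
qed

lemma box_bump:
  fixes a b :: pt
  assumes ab: "box a b \<noteq> {}"
  obtains P :: "pt \<Rightarrow> real" where "\<And>x. P x \<ge> 0" "\<And>x. P x > 0 \<longleftrightarrow> x \<in> box a b"
    "\<And>x. P differentiable (at x)" "\<And>i. continuous_on UNIV (partial i P)"
proof -
  have lt: "a $ i < b $ i" for i
    using ab by (auto simp: interval_ne_empty_cart)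
  \<comment> \<open>A quadratic that is positive exactly between the two endpoints; its squared
    positive part is a one-dimensional bump, and the product over both coordinates is positive
    exactly on the open box.\<close>
  define s where "s i t = (t - a $ i) * (b $ i - t)" for i :: 2 and t :: real
  define q where "q i t = (max 0 (s i t))\<^sup>2" for i t
  define q' where "q' i t = 2 * max 0 (s i t) * (a $ i + b $ i - 2 * t)" for i t
  have dq: "(q i has_real_derivative q' i t) (at t)" for i t
  proof -
    have "(s i has_real_derivative (a $ i + b $ i - 2 * t)) (at t)"
      unfolding s_def by (auto intro!: derivative_eq_intros)
    from DERIV_chain2[OF has_real_derivative_pos_part_square this]
    show ?thesis unfolding q_def q'_def .
  qed
  have cq: "continuous_on UNIV (q i)" "continuous_on UNIV (q' i)" for i
    unfolding q_def q'_def s_def by (intro continuous_intros)+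
  have cq2: "continuous_on UNIV (\<lambda>x::pt. q i (x $ j))" "continuous_on UNIV (\<lambda>x::pt. q' i (x $ j))" for i j
    by (rule continuous_on_compose2[OF cq(1)] continuous_on_compose2[OF cq(2)]; auto intro!: continuous_intros)+
  have q0: "q i t \<ge> 0" for i t by (simp add: q_def)
  have qpos: "q i t > 0 \<longleftrightarrow> a $ i < t \<and> t < b $ i" for i t
    using lt[of i] by (auto simp: q_def s_def max_def zero_less_mult_iff zero_le_mult_iff)
  define P where "P x = q 1 (x $ 1) * q 2 (x $ 2)" for x :: pt
  have dP: "(P has_derivative (\<lambda>h. q 1 (x $ 1) * (q' 2 (x $ 2) * h $ 2) + q' 1 (x $ 1) * h $ 1 * q 2 (x $ 2))) (at x)" for x
  proof -
    have "((\<lambda>x. q i (x $ i)) has_derivative (\<lambda>h. q' i (x $ i) * h $ i)) (at x)" for i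
    proof -
      have "(q i has_derivative (\<lambda>h. q' i (x $ i) * h)) (at (x $ i))"
        using dq[of i "x $ i"] by (simp add: has_field_derivative_def)
      moreover have "((\<lambda>x. x $ i) has_derivative (\<lambda>h. h $ i)) (at x)"
        by (rule bounded_linear_imp_has_derivative) (rule bounded_linear_vec_nth)
      ultimately show ?thesis
        using has_derivative_compose[of "\<lambda>x. x $ i" "\<lambda>h. h $ i" x UNIV "q i"] by simp
    qed
    from has_derivative_mult[OF this[of 1] this[of 2]] show ?thesis unfolding P_def .
  qed
  show ?thesis
  proof
    show "P x \<ge> 0" for x using q0 by (simp add: P_def)
    show "P x > 0 \<longleftrightarrow> x \<in> box a b" for x
      using q0[of 1 "x $ 1"] q0[of 2 "x $ 2"] qpos
      by (auto simp: P_def zero_less_mult_iff mem_box_cart forall_2)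
    show "P differentiable (at x)" for x using dP differentiable_def by blast
    show "continuous_on UNIV (partial i P)" for i
      unfolding partial_eqI[OF dP, abs_def] by (intro continuous_intros cq2)
  qed
qed

lemma test_functionE:
  assumes "test_function U \<psi>"
  obtains C where "compact C" "C \<subseteq> U" "\<And>x. x \<notin> C \<Longrightarrow> \<psi> x = 0" "\<And>i x. x \<notin> C \<Longrightarrow> partial i \<psi> x = 0"
    "continuous_on UNIV \<psi>" "\<And>i. continuous_on UNIV (partial i \<psi>)"
proof -
  obtain C where C: "compact C" "C \<subseteq> U" "\<And>x. x \<notin> C \<Longrightarrow> \<psi> x = 0"
    using assms by (auto simp: test_function_def)
  \<comment> \<open>The complement of the compact set is open, so \<open>\<psi>\<close> vanishes in
    a whole neighbourhood of \<open>x\<close>.\<close>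
  have "partial i \<psi> x = 0" if "x \<notin> C" for i x
  proof (rule partial_eqI[where f'="\<lambda>_. 0"])
    have "((\<lambda>_. 0) has_derivative (\<lambda>_. 0)) (at x)" by simp
    then show "(\<psi> has_derivative (\<lambda>_. 0)) (at x)"
      by (rule has_derivative_transform_within_open[of _ _ _ _ "- C"])
         (use C that in \<open>auto intro: compact_imp_closed\<close>)
  qed
  moreover have "continuous_on UNIV \<psi>"
    using assms by (auto simp: test_function_def continuous_at_imp_continuous_on differentiable_imp_continuous_within)
  ultimately show ?thesis
    using C assms that by (auto simp: test_function_def)
qed

lemma bounded_of_compact_support:
  fixes \<psi> :: "pt \<Rightarrow> real"
  assumes "continuous_on UNIV \<psi>" "compact C" "\<And>x. x \<notin> C \<Longrightarrow> \<psi> x = 0"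
  obtains B where "B \<ge> 0" "\<And>x. \<bar>\<psi> x\<bar> \<le> B"
proof -
  have "bounded (\<psi> ` C)"
    using assms by (intro compact_imp_bounded compact_continuous_image) (auto intro: continuous_on_subset)
  then obtain B where "B > 0" "\<forall>x\<in>C. norm (\<psi> x) \<le> B"
    unfolding bounded_pos by auto
  then show ?thesis using assms that[of B] by (metis less_eq_real_def norm_zero real_norm_def)
qed

lemma continuous_imp_borel_measurable_lebesgue:
  fixes f :: "'a::euclidean_space \<Rightarrow> real"
  assumes "continuous_on UNIV f"
  shows "f \<in> borel_measurable lebesgue"
  by (rule measurable_completion) (use borel_measurable_continuous_onI[OF assms] in simp)

lemma integrable_locally_integrable_times:
  assumes "open U" "locally_integrable U h" "continuous_on UNIV \<psi>" "compact C" "C \<subseteq> U"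
    "\<And>x. x \<notin> C \<Longrightarrow> \<psi> x = 0"
  shows "set_integrable lebesgue U (\<lambda>x. h x * \<psi> x)"
proof -
  obtain B where B: "B \<ge> 0" "\<And>x. \<bar>\<psi> x\<bar> \<le> B"
    using bounded_of_compact_support[OF assms(3,4,6)] by blast
  have hC: "integrable lebesgue (\<lambda>x. indicator C x * h x)"
    using assms by (auto simp: locally_integrable_def set_integrable_def)
  have \<psi>: "\<psi> \<in> borel_measurable lebesgue"
    by (rule continuous_imp_borel_measurable_lebesgue[OF assms(3)])
  have "integrable lebesgue (\<lambda>x. (indicator C x * h x) * \<psi> x)"
  proof (rule Bochner_Integration.integrable_bound)
    show "integrable lebesgue (\<lambda>x. B * (indicator C x * h x))" using hC by simp
    show "(\<lambda>x. indicator C x * h x * \<psi> x) \<in> borel_measurable lebesgue"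
      using borel_measurable_integrable[OF hC] \<psi> by measurable
    show "AE x in lebesgue. norm (indicator C x * h x * \<psi> x) \<le> norm (B * (indicator C x * h x))"
      using B by (auto simp: abs_mult mult.commute intro!: mult_right_mono)
  qed
  also have "(\<lambda>x. (indicator C x * h x) * \<psi> x) = (\<lambda>x. indicator U x *\<^sub>R (h x * \<psi> x))"
    using assms(5,6) by (auto simp: indicator_def fun_eq_iff)
  finally show ?thesis by (simp add: set_integrable_def)
qed

lemma partial_one_minus_exp:
  assumes "P differentiable (at x)"
  shows "(\<lambda>x. 1 - exp (- (k * P x))) differentiable (at x)"
    and "partial i (\<lambda>x. 1 - exp (- (k * P x))) x = k * exp (- (k * P x)) * partial i P x"
proof -
  obtain P' where P': "(P has_derivative P') (at x)" using assms by (auto simp: differentiable_def)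
  have "((\<lambda>x. 1 - exp (- (k * P x))) has_derivative (\<lambda>h. k * exp (- (k * P x)) * P' h)) (at x)"
    by (auto intro!: derivative_eq_intros P')
  from partial_eqI[OF this] this partial_eqI[OF P']
  show "(\<lambda>x. 1 - exp (- (k * P x))) differentiable (at x)"
    and "partial i (\<lambda>x. 1 - exp (- (k * P x))) x = k * exp (- (k * P x)) * partial i P x"
    by (auto simp: differentiable_def)
qed

text \<open>For a bump \<open>P\<close> of the box, the functions \<open>1 - exp (- n P)\<close> lie
  between 0 and 1, vanish outside the box and tend to 1 inside it. Dominated convergence replaces
  them by the indicator of the open box. The closed box has to lie in \<open>U\<close> because it
  serves as the compact support.\<close>

lemma LINT_box_zero_of_test_functions:
  assumes "open U" "locally_integrable U h"
    and zero: "\<And>\<psi>. test_function U \<psi> \<Longrightarrow> (LINT x:U|lebesgue. h x * \<psi> x) = 0"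
    and sub: "cbox a b \<subseteq> U"
  shows "(LINT x:box a b|lebesgue. h x) = 0"
proof (cases "box a b = {}")
  case True then show ?thesis by (simp add: set_lebesgue_integral_def)
next
  case False
  then obtain P where P: "\<And>x. P x \<ge> 0" "\<And>x. P x > 0 \<longleftrightarrow> x \<in> box a b"
    "\<And>x. P differentiable (at x)" "\<And>i. continuous_on UNIV (partial i P)"
    using box_bump by metis
  define \<psi> where "\<psi> n x = 1 - exp (- (real n * P x))" for n x
  have Pc: "continuous_on UNIV P"
    using P(3) by (simp add: continuous_at_imp_continuous_on differentiable_imp_continuous_within)
  have P0: "P x = 0" if "x \<notin> box a b" for x using P(1)[of x] P(2)[of x] that by linarith
  have P0c: "P x = 0" if "x \<notin> cbox a b" for x
    using that box_subset_cbox[of a b] by (intro P0) auto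
  have test: "test_function U (\<psi> n)" for n
    unfolding test_function_def
  proof (intro conjI allI exI[of _ "cbox a b"])
    show "\<psi> n differentiable (at x)" for x
      using partial_one_minus_exp(1)[OF P(3)] by (simp add: \<psi>_def[abs_def])
    show "continuous_on UNIV (partial i (\<psi> n))" for i
      unfolding \<psi>_def[abs_def] partial_one_minus_exp(2)[OF P(3), abs_def]
      by (intro continuous_intros P Pc)
  qed (use sub P0c in \<open>auto simp: \<psi>_def\<close>)
  define f where "f x = indicator (cbox a b) x * h x" for x
  have f: "integrable lebesgue f"
    using assms by (auto simp: locally_integrable_def set_integrable_def f_def[abs_def])
  have "(\<lambda>n. LINT x|lebesgue. f x * \<psi> n x) \<longlonglongrightarrow> (LINT x|lebesgue. f x * indicator (box a b) x)"
  proof (rule integral_dominated_convergence[where w="\<lambda>x. norm (f x)"])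
    show "(\<lambda>x. f x * indicator (box a b) x) \<in> borel_measurable lebesgue"
      by (intro borel_measurable_times borel_measurable_integrable[OF f] borel_measurable_indicator) auto
    have "continuous_on UNIV (\<psi> n)" for n unfolding \<psi>_def[abs_def] by (intro continuous_intros Pc)
    then have "\<psi> n \<in> borel_measurable lebesgue" for n
      by (rule continuous_imp_borel_measurable_lebesgue)
    then show "(\<lambda>x. f x * \<psi> n x) \<in> borel_measurable lebesgue" for n
      using borel_measurable_integrable[OF f] by measurable
    show "AE x in lebesgue. (\<lambda>n. f x * \<psi> n x) \<longlonglongrightarrow> f x * indicator (box a b) x"
    proof (intro AE_I2 tendsto_mult tendsto_const)
      fix x
      show "(\<lambda>n. \<psi> n x) \<longlonglongrightarrow> indicator (box a b) x"
      proof (cases "x \<in> box a b")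
        case True
        have eq: "\<psi> n x = 1 - exp (- P x) ^ n" for n
          by (simp add: \<psi>_def exp_of_nat_mult[symmetric])
        have "P x > 0" using P True by simp
        then have "(\<lambda>n. exp (- P x) ^ n) \<longlonglongrightarrow> 0" 
          by (intro LIMSEQ_realpow_zero) auto
        then have "(\<lambda>n. 1 - exp (- P x) ^ n) \<longlonglongrightarrow> 1 - 0"
          by (rule tendsto_diff[OF tendsto_const])
        then have "(\<lambda>n. \<psi> n x) \<longlonglongrightarrow> 1"
          by (simp only: eq diff_zero)
        then show ?thesis using True by simp
      next
        case False then show ?thesis using P0 by (simp add: \<psi>_def)
      qed
    qed
    show "AE x in lebesgue. norm (f x * \<psi> n x) \<le> norm (f x)" for n
    proof (rule AE_I2)
      fix x
      have "\<bar>\<psi> n x\<bar> \<le> 1" using P(1)[of x] by (auto simp: \<psi>_def)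
      then show "norm (f x * \<psi> n x) \<le> norm (f x)" by (simp add: abs_mult mult_left_le)
    qed
  qed (use f in auto)
  moreover have "(LINT x|lebesgue. f x * \<psi> n x) = 0" for n
  proof -
    have "(LINT x|lebesgue. f x * \<psi> n x) = (LINT x:U|lebesgue. h x * \<psi> n x)"
      unfolding set_lebesgue_integral_def
      by (rule Bochner_Integration.integral_cong)
         (use sub P0c in \<open>auto simp: f_def indicator_def \<psi>_def\<close>)
    then show ?thesis using zero[OF test] by simp
  qed
  ultimately have "(LINT x|lebesgue. f x * indicator (box a b) x) = 0"
    by (simp add: LIMSEQ_const_iff)
  moreover have "(LINT x|lebesgue. f x * indicator (box a b) x) = (LINT x:box a b|lebesgue. h x)"
    unfolding set_lebesgue_integral_def
    by (rule Bochner_Integration.integral_cong)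
       (use box_subset_cbox[of a b] in \<open>auto simp: f_def indicator_def\<close>)
  ultimately show ?thesis by simp
qed

text \<open>The box criterion needs an integrable function on the whole plane, whereas
  \<open>h\<close> is only locally integrable; hence the argument runs on one closed box in
  \<open>U\<close> at a time, with \<open>h\<close> truncated to its interior, and countably many
  such boxes cover \<open>U\<close>.\<close>

lemma AE_zero_of_test_functions:
  assumes U: "open U" and h: "locally_integrable U h"
    and zero: "\<And>\<psi>. test_function U \<psi> \<Longrightarrow> (LINT x:U|lebesgue. h x * \<psi> x) = 0"
  shows "AE x in lebesgue. x \<in> U \<longrightarrow> h x = 0"
proof -
  have cb: "AE x in lebesgue. x \<in> cbox a b \<longrightarrow> h x = 0" if sub: "cbox a b \<subseteq> U" for a b
  proof -
    have "integrable lebesgue (\<lambda>x. indicator (cbox a b) x * h x)"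
      using h sub by (auto simp: locally_integrable_def set_integrable_def)
    then have "integrable lebesgue (\<lambda>x. indicator (box a b) x *\<^sub>R (indicator (cbox a b) x * h x))"
      by (intro integrable_mult_indicator) auto
    moreover have "(\<lambda>x. indicator (box a b) x *\<^sub>R (indicator (cbox a b) x * h x)) = (\<lambda>x. indicator (box a b) x * h x)"
      using box_subset_cbox[of a b] by (auto simp: indicator_def fun_eq_iff)
    ultimately have int: "integrable lebesgue (\<lambda>x. indicator (box a b) x * h x)" by simp
    have sub': "cbox c d \<subseteq> U" if "cbox c d \<subseteq> cbox a b" for c d using sub that by auto
    have "AE x in lebesgue. indicator (box a b) x * h x = 0"
    proof (rule integrable_lebesgue_zero_on_boxes_imp_AE_zero[OF int])
      show "(LINT x|lebesgue. indicator (box a b) x * h x) = 0"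
        using LINT_box_zero_of_test_functions[OF U h zero sub] by (simp add: set_lebesgue_integral_def)
      fix c d :: pt
      obtain c' d' where cd: "box c d \<inter> box a b = box c' d'" using box_Int_box by blast
      \<comment> \<open>The intersection of two boxes is a box, so an integral of the truncated
        function over any box is an integral of \<open>h\<close> over a smaller box.\<close>
      have "(LINT x:box c d|lebesgue. indicator (box a b) x * h x) = (LINT x:box c' d'|lebesgue. h x)"
        unfolding set_lebesgue_integral_def cd[symmetric]
        by (rule Bochner_Integration.integral_cong) (auto simp: indicator_def)
      also have "\<dots> = 0"
      proof (cases "box c' d' = {}")
        case True then show ?thesis by (simp add: set_lebesgue_integral_def)
      next
        case False
        have "cbox c' d' = closure (box c' d')" using closure_box[OF False] by simp
        also have "\<dots> \<subseteq> cbox a b"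
          using cd box_subset_cbox[of a b] by (intro closure_minimal closed_cbox) blast
        finally show ?thesis
          by (intro LINT_box_zero_of_test_functions[OF U h] zero sub')
      qed
      finally show "(LINT x:box c d|lebesgue. indicator (box a b) x * h x) = 0" .
    qed
    \<comment> \<open>The covering below uses closed boxes; their boundaries are null sets and may
      be added.\<close>
    moreover have "negligible (cbox a b - box a b)" by (rule negligible_frontier_interval)
    then have "AE x in lebesgue. x \<notin> cbox a b - box a b"
      by (intro AE_not_in) (simp add: negligible_iff_null_sets)
    ultimately show ?thesis by eventually_elim auto
  qed
  obtain \<D> where D: "countable \<D>" "\<D> \<subseteq> Pow U" "\<And>X. X \<in> \<D> \<Longrightarrow> \<exists>a b. X = cbox a b" "\<Union>\<D> = U"
    using open_countable_Union_open_cbox[OF U] by metis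
  have "AE x in lebesgue. \<forall>X\<in>\<D>. x \<in> X \<longrightarrow> h x = 0"
  proof (intro AE_ball_countable[THEN iffD2, OF D(1)] ballI)
    fix X assume X: "X \<in> \<D>"
    then obtain a b where "X = cbox a b" using D(3) by metis
    then show "AE x in lebesgue. x \<in> X \<longrightarrow> h x = 0" using cb[of a b] X D(2) by auto
  qed
  then show ?thesis by eventually_elim (use D(4) in blast)
qed

text \<open>Both candidates have the same integral against every test function, so the fundamental
  lemma applies to their difference. This is what gives \<open>weak_partial\<close> a definite
  meaning up to null sets.\<close>

lemma has_weak_partial_unique:
  assumes U: "open U" and "has_weak_partial U i u w1" "has_weak_partial U i u w2"
  shows "AE x in lebesgue. x \<in> U \<longrightarrow> w1 x = w2 x"
proof -
  have w: "locally_integrable U w1" "locally_integrable U w2"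
    using assms by (auto simp: has_weak_partial_def)
  have "AE x in lebesgue. x \<in> U \<longrightarrow> w1 x - w2 x = 0"
  proof (rule AE_zero_of_test_functions[OF U])
    show "locally_integrable U (\<lambda>x. w1 x - w2 x)"
      using w unfolding locally_integrable_def by (blast intro: set_integral_diff(1))
    fix \<psi> assume \<psi>: "test_function U \<psi>"
    then obtain C where C: "compact C" "C \<subseteq> U" "\<And>x. x \<notin> C \<Longrightarrow> \<psi> x = 0" "continuous_on UNIV \<psi>"
      using test_functionE by metis
    note i = integrable_locally_integrable_times[OF U _ C(4,1,2,3)]
    have "(LINT x:U|lebesgue. (w1 x - w2 x) * \<psi> x)
        = (LINT x:U|lebesgue. w1 x * \<psi> x) - (LINT x:U|lebesgue. w2 x * \<psi> x)"
      using set_integral_diff(2)[OF i[OF w(1)] i[OF w(2)]] by (simp add: left_diff_distrib)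
    also have "\<dots> = 0"
    proof -
      have "(LINT x:U|lebesgue. u x * partial i \<psi> x) = - (LINT x:U|lebesgue. w1 x * \<psi> x)"
        "(LINT x:U|lebesgue. u x * partial i \<psi> x) = - (LINT x:U|lebesgue. w2 x * \<psi> x)"
        using assms(2,3) \<psi> unfolding has_weak_partial_def by blast+
      then show ?thesis by linarith
    qed
    finally show "(LINT x:U|lebesgue. (w1 x - w2 x) * \<psi> x) = 0" .
  qed
  then show ?thesis by simp
qed

section \<open>Integration by parts against affine functions\<close>

lemma integrable_lborel_compact_support:
  fixes f :: "'a::euclidean_space \<Rightarrow> real"
  assumes "continuous_on UNIV f" "compact C" "\<And>x. x \<notin> C \<Longrightarrow> f x = 0"
  shows "integrable lborel f"
proof -
  have "integrable lborel (\<lambda>x. indicator C x *\<^sub>R f x)"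
    using assms by (intro borel_integrable_compact) (auto intro: continuous_on_subset)
  also have "(\<lambda>x. indicator C x *\<^sub>R f x) = f"
    using assms(3) by (auto simp: indicator_def fun_eq_iff)
  finally show ?thesis .
qed

lemma LINT_lborel_translate:
  fixes f :: "'a::euclidean_space \<Rightarrow> real"
  assumes "f \<in> borel_measurable borel"
  shows "(LINT x|lborel. f (a + x)) = (LINT x|lborel. f x)"
proof -
  have "(LINT x|lborel. f x) = (LINT x|distr lborel borel ((+) a). f x)"
    by (simp add: lborel_distr_plus)
  also have "\<dots> = (LINT x|lborel. f (a + x))"
    using assms by (intro integral_distr) auto
  finally show ?thesis by simp
qed

lemma test_function_line_derivative:
  assumes "test_function U \<psi>"
  shows "((\<lambda>t. \<psi> (x + t *\<^sub>R axis i 1)) has_real_derivative partial i \<psi> (x + t *\<^sub>R axis i 1)) (at t)"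
proof -
  let ?e = "axis i 1 :: pt"
  have "(\<psi> has_derivative frechet_derivative \<psi> (at (x + t *\<^sub>R ?e))) (at (x + t *\<^sub>R ?e))"
    using assms by (simp add: test_function_def frechet_derivative_works[symmetric])
  moreover have "((\<lambda>t. x + t *\<^sub>R ?e) has_derivative (\<lambda>s. s *\<^sub>R ?e)) (at t)"
    by (auto intro!: derivative_eq_intros)
  ultimately have "((\<lambda>t. \<psi> (x + t *\<^sub>R ?e)) has_derivative
      (\<lambda>s. frechet_derivative \<psi> (at (x + t *\<^sub>R ?e)) (s *\<^sub>R ?e))) (at t)"
    using has_derivative_compose by fastforce
  moreover have "linear (frechet_derivative \<psi> (at (x + t *\<^sub>R ?e)))"
    using assms by (intro linear_frechet_derivative) (simp add: test_function_def)
  then have "(\<lambda>s. frechet_derivative \<psi> (at (x + t *\<^sub>R ?e)) (s *\<^sub>R ?e))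
      = (\<lambda>s. partial i \<psi> (x + t *\<^sub>R ?e) * s)"
    by (auto simp: partial_def linear_cmul)
  ultimately show ?thesis by (simp add: has_field_derivative_def)
qed

text \<open>The difference quotient is moved onto the affine factor by translation invariance of the
  integral, so that neither Fubini's theorem nor Green's formula is needed.\<close>
lemma LINT_affine_times_partial:
  assumes \<psi>: "test_function U \<psi>"
  shows "(LINT x|lborel. (k + c \<bullet> x) * partial i \<psi> x) = - (c $ i) * (LINT x|lborel. \<psi> x)"
proof -
  obtain C where C: "compact C" "\<And>x. x \<notin> C \<Longrightarrow> \<psi> x = 0" "\<And>x. x \<notin> C \<Longrightarrow> partial i \<psi> x = 0"
    "continuous_on UNIV \<psi>" "continuous_on UNIV (partial i \<psi>)"
    using test_functionE[OF \<psi>] by metis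
  obtain M where M: "\<And>x. \<bar>partial i \<psi> x\<bar> \<le> M"
    using bounded_of_compact_support[OF C(5,1,3)] by metis
  obtain R where R: "\<And>x. x \<in> C \<Longrightarrow> norm x \<le> R"
    using compact_imp_bounded[OF C(1)] by (auto simp: bounded_iff)
  define e where "e = (axis i 1 :: pt)"
  \<comment> \<open>Step sizes in (0, 1]: the difference quotients then all vanish outside the ball
    of radius \<open>R + 1\<close>, so one function \<open>w\<close> dominates them for every
    \<open>n\<close>.\<close>
  define h where "h n = 1 / (real n + 1)" for n :: nat
  have h: "0 < h n" "h n \<le> 1" for n by (auto simp: h_def)
  have ne: "norm e = 1" by (simp add: e_def)
  have ce: "c \<bullet> e = c $ i" by (simp add: e_def inner_axis)
  define F where "F n x = (k + c \<bullet> x) * ((\<psi> (h n *\<^sub>R e + x) - \<psi> x) / h n)" for n x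
  have int\<psi>: "integrable lborel \<psi>" by (rule integrable_lborel_compact_support[OF C(4,1,2)])
  have LF: "(LINT x|lborel. F n x) = - (c $ i) * (LINT x|lborel. \<psi> x)" for n
  proof -
    \<comment> \<open>Chosen so that translating \<open>G\<close> by the step gives the shifted half
      of \<open>F n\<close>. The translate has the same integral as \<open>G\<close>, and
      \<open>G\<close> differs from \<open>G0\<close> only by the constant
      \<open>- h n * c $ i\<close> times \<open>\<psi>\<close>; the step size cancels and the
      integral does not depend on \<open>n\<close>.\<close>
    define G where "G y = (k + c \<bullet> (y - h n *\<^sub>R e)) * \<psi> y" for y
    define G0 where "G0 y = (k + c \<bullet> y) * \<psi> y" for y
    have Gc: "continuous_on UNIV G" "continuous_on UNIV G0"
      unfolding G_def G0_def by (intro continuous_intros C)+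
    have Gi: "integrable lborel G" "integrable lborel G0"
      by (rule integrable_lborel_compact_support[OF Gc(1) C(1)], simp add: G_def C)
         (rule integrable_lborel_compact_support[OF Gc(2) C(1)], simp add: G0_def C)
    have GT: "integrable lborel (\<lambda>x. G (h n *\<^sub>R e + x))"
    proof (rule integrable_lborel_compact_support)
      show "continuous_on UNIV (\<lambda>x. G (h n *\<^sub>R e + x))"
        by (rule continuous_on_compose2[OF Gc(1)]) (auto intro!: continuous_intros)
      show "compact ((\<lambda>x. - (h n *\<^sub>R e) + x) ` C)"
        using C(1) by (rule compact_translation)
      show "G (h n *\<^sub>R e + x) = 0" if "x \<notin> (\<lambda>x. - (h n *\<^sub>R e) + x) ` C" for x
      proof -
        have "h n *\<^sub>R e + x \<notin> C" using that by (force simp: image_iff)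
        then show ?thesis by (simp add: G_def C)
      qed
    qed
    have "(LINT x|lborel. F n x) = (LINT x|lborel. (G (h n *\<^sub>R e + x) - G0 x) / h n)"
      by (rule Bochner_Integration.integral_cong) (auto simp: F_def G_def G0_def right_diff_distrib)
    also have "\<dots> = ((LINT x|lborel. G (h n *\<^sub>R e + x)) - (LINT x|lborel. G0 x)) / h n"
      using Bochner_Integration.integral_diff[OF GT Gi(2)] by simp
    also have "(LINT x|lborel. G (h n *\<^sub>R e + x)) = (LINT x|lborel. G x)"
      by (rule LINT_lborel_translate) (rule borel_measurable_continuous_onI[OF Gc(1)])
    also have "(LINT x|lborel. G x) - (LINT x|lborel. G0 x) = (LINT x|lborel. G x - G0 x)"
      using Bochner_Integration.integral_diff[OF Gi] by simp
    also have "\<dots> = (LINT x|lborel. - (h n * c $ i) * \<psi> x)"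
      by (rule Bochner_Integration.integral_cong)
         (auto simp: G_def G0_def inner_diff_right ce algebra_simps)
    also have "\<dots> / h n = - (c $ i) * (LINT x|lborel. \<psi> x)"
      using h(1)[of n] by simp
    finally show ?thesis .
  qed
  define w where "w x = indicator (cball 0 (R + 1)) x *\<^sub>R (\<bar>k + c \<bullet> x\<bar> * M)" for x :: pt
  have "(\<lambda>n. LINT x|lborel. F n x) \<longlonglongrightarrow> (LINT x|lborel. (k + c \<bullet> x) * partial i \<psi> x)"
  proof (rule integral_dominated_convergence[where w=w])
    show "(\<lambda>x. (k + c \<bullet> x) * partial i \<psi> x) \<in> borel_measurable lborel"
      using borel_measurable_continuous_onI[of "\<lambda>x. (k + c \<bullet> x) * partial i \<psi> x"]
      by (simp add: continuous_intros C)
    have "continuous_on UNIV (F n)" for n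
    proof -
      have "continuous_on UNIV (\<lambda>x. \<psi> (h n *\<^sub>R e + x))"
        by (rule continuous_on_compose2[OF C(4)]) (auto intro!: continuous_intros)
      then show ?thesis unfolding F_def[abs_def] using h(1)[of n]
        by (intro continuous_intros C) auto
    qed
    then show "F n \<in> borel_measurable lborel" for n
      using borel_measurable_continuous_onI[of "F n"] by simp
    show "integrable lborel w"
      unfolding w_def[abs_def] by (intro borel_integrable_compact) (auto intro!: continuous_intros)
    show "AE x in lborel. (\<lambda>n. F n x) \<longlonglongrightarrow> (k + c \<bullet> x) * partial i \<psi> x"
    proof (rule AE_I2)
      fix x
      have "((\<lambda>t. \<psi> (x + t *\<^sub>R e)) has_real_derivative partial i \<psi> (x + 0 *\<^sub>R e)) (at 0)"
        unfolding e_def by (rule test_function_line_derivative[OF \<psi>])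
      then have "((\<lambda>t. (\<psi> (x + t *\<^sub>R e) - \<psi> x) / t) \<longlongrightarrow> partial i \<psi> x) (at 0)"
        by (simp add: DERIV_def)
      moreover have "filterlim h (at 0) sequentially"
      proof -
        have "h \<longlonglongrightarrow> 0" unfolding h_def
          using LIMSEQ_inverse_real_of_nat by (simp add: inverse_eq_divide add.commute)
        then show ?thesis using h(1) by (auto simp: filterlim_at less_imp_neq[symmetric])
      qed
      ultimately have "(\<lambda>n. (\<psi> (x + h n *\<^sub>R e) - \<psi> x) / h n) \<longlonglongrightarrow> partial i \<psi> x"
        by (rule filterlim_compose)
      then show "(\<lambda>n. F n x) \<longlonglongrightarrow> (k + c \<bullet> x) * partial i \<psi> x"
        unfolding F_def by (intro tendsto_mult tendsto_const) (simp add: add.commute)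
    qed
    show "AE x in lborel. norm (F n x) \<le> w x" for n
    proof (rule AE_I2)
      fix x
      show "norm (F n x) \<le> w x"
      proof (cases "norm x \<le> R + 1")
        case False
        have "norm x - norm (h n *\<^sub>R e) \<le> norm (x + h n *\<^sub>R e)"
          by (metis add_diff_cancel norm_triangle_ineq2 norm_triangle_ineq4 diff_le_eq)
        then have "R < norm (h n *\<^sub>R e + x)"
          using False h[of n] ne by (simp add: add.commute)
        then have "h n *\<^sub>R e + x \<notin> C" "x \<notin> C" using R False by force+
        then have "F n x = 0" using C by (simp add: F_def)
        then show ?thesis using False by (simp add: w_def)
      next
        case True
        \<comment> \<open>The mean value theorem turns the difference quotient into a partial
          derivative at an intermediate point, which is bounded by \<open>M\<close> independently of
          \<open>n\<close>.\<close>
        have "\<exists>z>0. z < h n \<and> \<psi> (x + h n *\<^sub>R e) - \<psi> (x + 0 *\<^sub>R e) = (h n - 0) * partial i \<psi> (x + z *\<^sub>R e)"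
          by (rule MVT2[of 0 "h n" "\<lambda>t. \<psi> (x + t *\<^sub>R e)"])
             (use h test_function_line_derivative[OF \<psi>] in \<open>auto simp: e_def\<close>)
        then obtain z where "\<psi> (x + h n *\<^sub>R e) - \<psi> x = h n * partial i \<psi> (x + z *\<^sub>R e)" by auto
        then have "(\<psi> (h n *\<^sub>R e + x) - \<psi> x) / h n = partial i \<psi> (x + z *\<^sub>R e)"
          using h(1)[of n] by (simp add: add.commute field_simps)
        then show ?thesis using True M[of "x + z *\<^sub>R e"]
          by (auto simp: F_def w_def abs_mult intro!: mult_left_mono)
      qed
    qed
  qed
  with LF show ?thesis by (simp add: LIMSEQ_const_iff)
qed

text \<open>Test functions are supported inside \<open>U\<close>, so integrals over \<open>U\<close>
  are integrals over the plane, where the translation argument works. The hypothesis is kept almost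
  everywhere because it is later applied to a function that is itself a chosen weak
  derivative.\<close>

lemma has_weak_partial_affine:
  assumes U: "open U" and u: "AE x in lebesgue. x \<in> U \<longrightarrow> u x = k + c \<bullet> x"
  shows "has_weak_partial U i u (\<lambda>_. c $ i)"
proof -
  define v where "v x = k + c \<bullet> x" for x
  have vc: "continuous_on S v" for S unfolding v_def by (intro continuous_intros)
  have ae: "AE x in lebesgue. x \<in> U \<longrightarrow> v x = u x"
    using u by eventually_elim (simp add: v_def)
  have vi: "set_integrable lebesgue S f" if "compact S" "continuous_on S f" for S and f :: "pt \<Rightarrow> real"
    using borel_integrable_compact[OF that] 
    by (simp add: set_integrable_def integrable_completion borel_measurable_integrable)
  have "locally_integrable U u"
    unfolding locally_integrable_def
  proof (intro allI impI, elim conjE)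
    fix C assume C: "compact C" "C \<subseteq> U"
    have i: "integrable lebesgue (\<lambda>x. indicator C x *\<^sub>R v x)"
      using vi[OF C(1) vc] by (simp add: set_integrable_def)
    have ae': "AE x in lebesgue. indicator C x *\<^sub>R v x = indicator C x *\<^sub>R u x"
      using ae by eventually_elim (use C in \<open>auto simp: indicator_def\<close>)
    show "set_integrable lebesgue C u" unfolding set_integrable_def
      by (rule integrable_cong_AE_imp[OF i borel_measurable_AE[OF borel_measurable_integrable[OF i] ae']])
         (use ae' in \<open>eventually_elim, simp\<close>)
  qed
  moreover have "locally_integrable U (\<lambda>_. c $ i)"
    unfolding locally_integrable_def using vi by auto
  moreover have "(LINT x:U|lebesgue. u x * partial i \<psi> x) = - (LINT x:U|lebesgue. c $ i * \<psi> x)"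
    if \<psi>: "test_function U \<psi>" for \<psi>
  proof -
    obtain C where C: "compact C" "C \<subseteq> U" "\<And>x. x \<notin> C \<Longrightarrow> \<psi> x = 0" "\<And>x. x \<notin> C \<Longrightarrow> partial i \<psi> x = 0"
      "continuous_on UNIV \<psi>" "continuous_on UNIV (partial i \<psi>)"
      using test_functionE[OF \<psi>] by metis
    have c1: "continuous_on UNIV (\<lambda>x. v x * partial i \<psi> x)" by (intro continuous_intros vc C)
    have ae': "AE x in lebesgue. v x * partial i \<psi> x = indicator U x *\<^sub>R (u x * partial i \<psi> x)"
      using ae by eventually_elim (use C in \<open>auto simp: indicator_def\<close>)
    then have ae2: "AE x in lebesgue. indicator U x *\<^sub>R (u x * partial i \<psi> x) = v x * partial i \<psi> x"
      by eventually_elim (rule sym)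
    have m: "(\<lambda>x. v x * partial i \<psi> x) \<in> borel_measurable lebesgue"
      by (rule continuous_imp_borel_measurable_lebesgue[OF c1])
    have "(LINT x:U|lebesgue. u x * partial i \<psi> x) = (LINT x|lebesgue. v x * partial i \<psi> x)"
      unfolding set_lebesgue_integral_def
      by (rule integral_cong_AE[OF borel_measurable_AE[OF m ae'] m ae2])
    also have "\<dots> = (LINT x|lborel. v x * partial i \<psi> x)"
      using borel_measurable_continuous_onI[OF c1] by (intro integral_completion) simp
    also have "\<dots> = - (c $ i) * (LINT x|lborel. \<psi> x)"
      unfolding v_def by (rule LINT_affine_times_partial[OF \<psi>])
    also have "(LINT x|lborel. \<psi> x) = (LINT x|lebesgue. \<psi> x)"
      using borel_measurable_continuous_onI[OF C(5)] by (intro integral_completion[symmetric]) simp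
    also have "\<dots> = (LINT x:U|lebesgue. \<psi> x)"
      unfolding set_lebesgue_integral_def
      by (rule Bochner_Integration.integral_cong) (use C in \<open>auto simp: indicator_def\<close>)
    finally show ?thesis by simp
  qed
  ultimately show ?thesis by (simp add: has_weak_partial_def)
qed

lemma weak_partial_affine:
  assumes U: "open U" and u: "AE x in lebesgue. x \<in> U \<longrightarrow> u x = k + c \<bullet> x"
  shows "AE x in lebesgue. x \<in> U \<longrightarrow> weak_partial U i u x = c $ i"
proof (rule has_weak_partial_unique[OF U])
  show "has_weak_partial U i u (weak_partial U i u)"
    using someI[of "has_weak_partial U i u", OF has_weak_partial_affine[OF assms]]
    by (simp add: weak_partial_def[abs_def])
qed (rule has_weak_partial_affine[OF assms])

lemma weak_partial_const:
  assumes U: "open U" and u: "AE x in lebesgue. x \<in> U \<longrightarrow> u x = k"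
  shows "AE x in lebesgue. x \<in> U \<longrightarrow> weak_partial U i u x = 0"
  using weak_partial_affine[OF U, of u k 0 i] u by simp

section \<open>Triangles in the plane\<close>

text \<open>Twice the signed area of the triangle spanned by \<open>u\<close> and
  \<open>v\<close>.\<close>

definition cross2 :: "pt \<Rightarrow> pt \<Rightarrow> real" where
  "cross2 u v = u $ 1 * v $ 2 - u $ 2 * v $ 1"

text \<open>An orientation rather than mere noncollinearity: it decides on which side of each edge
  the triangle lies, and hence the direction of the outward normal.\<close>

definition ccw :: "pt \<Rightarrow> pt \<Rightarrow> pt \<Rightarrow> bool" where
  "ccw a b c \<longleftrightarrow> 0 < cross2 (b - a) (c - a)"

lemma inner_pt: "(x::pt) \<bullet> y = x $ 1 * y $ 1 + x $ 2 * y $ 2"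
  by (simp add: inner_vec_def sum_2)

lemma pt_eq_iff: "(x::pt) = y \<longleftrightarrow> x $ 1 = y $ 1 \<and> x $ 2 = y $ 2"
  by (simp add: vec_eq_iff forall_2)

lemma J_nth: "(J *v x) $ 1 = x $ 2" "(J *v x) $ 2 = - (x $ 1)"
  by (simp_all add: J_def matrix_vector_mult_def sum_2)

lemma norm_pt_sq: "(norm (x::pt))\<^sup>2 = (x $ 1)\<^sup>2 + (x $ 2)\<^sup>2"
  unfolding power2_norm_eq_inner inner_pt by (simp add: power2_eq_square)

lemma ccw_rotate: "ccw a b c \<longleftrightarrow> ccw b c a"
  by (simp add: ccw_def cross2_def algebra_simps)

text \<open>Collinearity is equality in the Cauchy-Schwarz inequality, and Lagrange's identity says
  that the defect is the square of \<open>cross2\<close>.\<close>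

lemma collinear_iff_cross2: "collinear {a, b, c} \<longleftrightarrow> cross2 (b - a) (c - a) = 0"
proof -
  let ?u = "b - a" and ?v = "c - a"
  have "collinear {a, b, c} \<longleftrightarrow> collinear {0, ?u, ?v}"
    unfolding insert_commute[of a b] by (rule collinear_3) (simp add: NO_MATCH_def)
  also have "\<dots> \<longleftrightarrow> \<bar>?u \<bullet> ?v\<bar> = norm ?u * norm ?v"
    by (simp add: norm_cauchy_schwarz_equal)
  also have "\<dots> \<longleftrightarrow> (?u \<bullet> ?v)\<^sup>2 = (norm ?u)\<^sup>2 * (norm ?v)\<^sup>2"
    using power2_eq_iff_nonneg[of "\<bar>?u \<bullet> ?v\<bar>" "norm ?u * norm ?v"]
    by (simp add: power_mult_distrib)
  also have "\<dots> \<longleftrightarrow> (cross2 ?u ?v)\<^sup>2 = 0"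
    unfolding norm_pt_sq inner_pt cross2_def by algebra
  finally show ?thesis by simp
qed

lemma ccw_distinct: "ccw a b c \<Longrightarrow> a \<noteq> b \<and> b \<noteq> c \<and> a \<noteq> c"
  by (auto simp: ccw_def cross2_def)

lemma ccw_affine_independent: "ccw a b c \<Longrightarrow> \<not> affine_dependent {a, b, c}"
  using collinear_3_eq_affine_dependent[of a b c] collinear_iff_cross2[of a b c] by (auto simp: ccw_def)

text \<open>Exchanging the two other vertices changes the sign of the area, so one of the two orders
  is counterclockwise.\<close>

lemma simplex_2_obtain_ccw:
  assumes "2 simplex K" "p extreme_point_of K"
  obtains a b where "K = convex hull {p, a, b}" "ccw p a b"
proof -
  obtain C where C: "\<not> affine_dependent C" "card C = 3" "K = convex hull C"
    using assms(1) by (auto simp: simplex_def)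
  have "p \<in> C" using assms(2) C by (simp add: extreme_point_of_convex_hull_affine_independent)
  with C(2) have "card (C - {p}) = 2" by simp
  then obtain a b where ab: "C - {p} = {a, b}" "a \<noteq> b" by (auto simp: card_2_iff)
  with \<open>p \<in> C\<close> have Ceq: "C = {p, a, b}" "p \<noteq> a" "p \<noteq> b" by auto
  with C(1) ab have "\<not> collinear {p, a, b}" by (simp add: collinear_3_eq_affine_dependent)
  moreover have "cross2 (b - p) (a - p) = - cross2 (a - p) (b - p)"
    by (simp add: cross2_def algebra_simps)
  ultimately have "ccw p a b \<or> ccw p b a"
    unfolding collinear_iff_cross2 ccw_def by linarith
  then show ?thesis
    using that[of a b] that[of b a] C(3) Ceq(1) by (auto simp: insert_commute)
qed

lemma simplex_2_obtain_ccw':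
  assumes "2 simplex K"
  obtains a b c where "K = convex hull {a, b, c}" "ccw a b c"
proof -
  obtain C where C: "\<not> affine_dependent C" "card C = 3" "K = convex hull C"
    using assms(1) by (auto simp: simplex_def)
  then obtain p where "p \<in> C" by fastforce
  then have "p extreme_point_of K" using C by (simp add: extreme_point_of_convex_hull_affine_independent)
  then show ?thesis using simplex_2_obtain_ccw[OF assms] that by metis
qed

lemma extreme_points_triangle:
  "ccw a b c \<Longrightarrow> p extreme_point_of (convex hull {a, b, c}) \<longleftrightarrow> p \<in> {a, b, c}"
  by (rule extreme_point_of_convex_hull_affine_independent[OF ccw_affine_independent])

text \<open>Faces of a simplex are hulls of sets of vertices, and affine independence makes
  dimension 1 the same as having two vertices.\<close>

lemma edges_triangle:
  assumes "ccw a b c"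
  shows "{e. e edge_of (convex hull {a, b, c})} = {closed_segment a b, closed_segment b c, closed_segment c a}"
proof -
  note ind = ccw_affine_independent[OF assms]
  have dist: "a \<noteq> b" "b \<noteq> c" "a \<noteq> c" using ccw_distinct[OF assms] by auto
  have ad: "aff_dim C' = 1 \<longleftrightarrow> card C' = 2" if "C' \<subseteq> {a, b, c}" for C'
    using aff_dim_affine_independent[OF affine_independent_subset[OF ind that]] by auto
  have "{C'. C' \<subseteq> {a, b, c} \<and> card C' = 2} = {{a, b}, {b, c}, {c, a}}"
  proof (intro equalityI subsetI)
    fix C' assume "C' \<in> {C'. C' \<subseteq> {a, b, c} \<and> card C' = 2}"
    then have "C' \<subseteq> {a, b, c}" "card C' = 2" by auto
    then obtain x y where "C' = {x, y}" "x \<noteq> y" by (auto simp: card_2_iff)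
    with \<open>C' \<subseteq> {a, b, c}\<close> show "C' \<in> {{a, b}, {b, c}, {c, a}}" by (auto simp: doubleton_eq_iff)
  qed (use dist in \<open>auto simp: card_2_iff\<close>)
  moreover have "{e. e edge_of (convex hull {a, b, c})} = (hull) convex ` {C'. C' \<subseteq> {a, b, c} \<and> card C' = 2}"
  proof (intro equalityI subsetI)
    fix e assume "e \<in> {e. e edge_of (convex hull {a, b, c})}"
    then obtain C' where "C' \<subseteq> {a, b, c}" "e = convex hull C'" "aff_dim e = 1"
      unfolding edge_of_def face_of_convex_hull_affine_independent[OF ind] by blast
    then show "e \<in> (hull) convex ` {C'. C' \<subseteq> {a, b, c} \<and> card C' = 2}"
      using ad[of C'] by (simp add: aff_dim_convex_hull)
  next
    fix e assume "e \<in> (hull) convex ` {C'. C' \<subseteq> {a, b, c} \<and> card C' = 2}"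
    then obtain C' where "C' \<subseteq> {a, b, c}" "e = convex hull C'" "card C' = 2" by blast
    then show "e \<in> {e. e edge_of (convex hull {a, b, c})}"
      unfolding edge_of_def face_of_convex_hull_affine_independent[OF ind]
      using ad[of C'] by (auto simp: aff_dim_convex_hull)
  qed
  ultimately show ?thesis by (simp add: segment_convex_hull)
qed

text \<open>Barycentric coordinates are ratios of signed areas; the identities are cleared of the
  denominator.\<close>

lemma barycentric_cross2:
  "cross2 (b - a) (c - a) *\<^sub>R x =
     cross2 (c - b) (x - b) *\<^sub>R a + cross2 (a - c) (x - c) *\<^sub>R b + cross2 (b - a) (x - a) *\<^sub>R c"
  "cross2 (c - b) (x - b) + cross2 (a - c) (x - c) + cross2 (b - a) (x - a) = cross2 (b - a) (c - a)"
  by (simp_all add: pt_eq_iff cross2_def algebra_simps)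

lemma cross2_barycentric:
  assumes "x = u *\<^sub>R a + v *\<^sub>R b + w *\<^sub>R c" "u + v + w = 1"
  shows "cross2 (b - a) (x - a) = w * cross2 (b - a) (c - a)"
    "cross2 (c - b) (x - b) = u * cross2 (b - a) (c - a)"
    "cross2 (a - c) (x - c) = v * cross2 (b - a) (c - a)"
proof -
  have u: "u = 1 - v - w" using assms(2) by simp
  show "cross2 (b - a) (x - a) = w * cross2 (b - a) (c - a)"
    "cross2 (c - b) (x - b) = u * cross2 (b - a) (c - a)"
    "cross2 (a - c) (x - c) = v * cross2 (b - a) (c - a)"
    unfolding assms(1) u by (simp_all add: cross2_def algebra_simps)
qed

text \<open>The triangle as the intersection of the half-planes to the left of its three directed
  edges. Up to the positive factor \<open>D\<close> the three conditions are the signs of the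
  barycentric coordinates.\<close>

lemma mem_triangle_iff:
  assumes "ccw a b c"
  shows "x \<in> convex hull {a, b, c} \<longleftrightarrow>
    0 \<le> cross2 (b - a) (x - a) \<and> 0 \<le> cross2 (c - b) (x - b) \<and> 0 \<le> cross2 (a - c) (x - c)"
proof -
  define D where "D = cross2 (b - a) (c - a)"
  have D: "D > 0" using assms by (simp add: ccw_def D_def)
  {
    assume "x \<in> convex hull {a, b, c}"
    then obtain u v w where u: "0 \<le> u" "0 \<le> v" "0 \<le> w" and s: "u + v + w = 1"
      and x: "x = u *\<^sub>R a + v *\<^sub>R b + w *\<^sub>R c"
      unfolding convex_hull_3 by blast
    have "0 \<le> cross2 (b - a) (x - a)" "0 \<le> cross2 (c - b) (x - b)" "0 \<le> cross2 (a - c) (x - c)"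
      using u D by (simp_all only: cross2_barycentric[OF x s] D_def[symmetric] mult_nonneg_nonneg less_imp_le)
  }
  moreover
  {
    assume *: "0 \<le> cross2 (b - a) (x - a)" "0 \<le> cross2 (c - b) (x - b)" "0 \<le> cross2 (a - c) (x - c)"
    define u v w where uvw: "u = cross2 (c - b) (x - b) / D" "v = cross2 (a - c) (x - c) / D" "w = cross2 (b - a) (x - a) / D"
    have "D *\<^sub>R x = (D * u) *\<^sub>R a + (D * v) *\<^sub>R b + (D * w) *\<^sub>R c"
      using barycentric_cross2(1)[of b a c x] D by (simp add: uvw D_def)
    also have "\<dots> = D *\<^sub>R (u *\<^sub>R a + v *\<^sub>R b + w *\<^sub>R c)"
      by (simp add: scaleR_right_distrib)
    finally have "x = u *\<^sub>R a + v *\<^sub>R b + w *\<^sub>R c"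
      using D by (simp only: scaleR_left_imp_eq[OF less_imp_neq[THEN not_sym]])
    moreover have "u + v + w = 1"
      using D barycentric_cross2(2)[of c b x a] by (simp add: uvw D_def add_divide_distrib[symmetric])
    moreover have "0 \<le> u" "0 \<le> v" "0 \<le> w" using * D by (simp_all add: uvw)
    ultimately have "x \<in> convex hull {a, b, c}" unfolding convex_hull_3 by blast
  }
  ultimately show ?thesis by blast
qed

lemma continuous_on_cross2 [continuous_intros]:
  assumes "continuous_on S f"
  shows "continuous_on S (\<lambda>x. cross2 u (f x - v))"
  unfolding cross2_def by (intro continuous_intros assms)

lemma open_cross2_pos: "open {x. 0 < cross2 u (x - v)}"
  by (rule open_Collect_less[of "\<lambda>_. 0" "\<lambda>x. cross2 u (x - v)",
        OF continuous_on_const continuous_on_cross2[OF continuous_on_id]])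

lemma mem_interior_triangleI:
  assumes "ccw a b c"
    and "0 < cross2 (b - a) (x - a)" "0 < cross2 (c - b) (x - b)" "0 < cross2 (a - c) (x - c)"
  shows "x \<in> interior (convex hull {a, b, c})"
proof (rule interiorI)
  let ?S = "{x. 0 < cross2 (b - a) (x - a)} \<inter> {x. 0 < cross2 (c - b) (x - b)} \<inter> {x. 0 < cross2 (a - c) (x - c)}"
  show "open ?S" by (intro open_Int open_cross2_pos)
  show "x \<in> ?S" using assms by simp
  show "?S \<subseteq> convex hull {a, b, c}"
  proof
    fix y assume "y \<in> ?S"
    then show "y \<in> convex hull {a, b, c}" unfolding mem_triangle_iff[OF assms(1)] by auto
  qed
qed

lemma interior_triangle_nonempty:
  assumes "ccw a b c"
  shows "interior (convex hull {a, b, c}) \<noteq> {}"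
proof -
  obtain x where x: "x = (1/3) *\<^sub>R a + (1/3) *\<^sub>R b + (1/3) *\<^sub>R c" by blast
  have s: "1 / 3 + 1 / 3 + 1 / 3 = (1::real)" by simp
  have "x \<in> interior (convex hull {a, b, c})"
    by (rule mem_interior_triangleI[OF assms]; unfold cross2_barycentric[OF x s])
       (use assms in \<open>simp_all add: ccw_def\<close>)
  then show ?thesis by blast
qed

text \<open>\<open>J\<close> turns clockwise by a right angle, hence to the right of the direction
  of travel, away from a counterclockwise triangle. For uniqueness, orthogonality to the edge leaves
  a multiple of \<open>J *v (b - a)\<close>, the third vertex fixes its sign and the norm its
  size.\<close>

lemma outward_normal_triangle:
  assumes "ccw a b c"
  shows "outward_normal (convex hull {a, b, c}) (closed_segment a b) = (1 / norm (b - a)) *\<^sub>R (J *v (b - a))"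
  unfolding outward_normal_def
proof (rule the_equality)
  let ?K = "convex hull {a, b, c}" and ?e = "closed_segment a b" and ?v = "b - a"
  let ?n = "(1 / norm ?v) *\<^sub>R (J *v ?v)"
  have v: "norm ?v > 0" using ccw_distinct[OF assms] by auto
  have Jin: "(J *v ?v) \<bullet> (z - x) = cross2 ?v (x - a) - cross2 ?v (z - a)" for x z
    by (simp add: inner_pt J_nth cross2_def algebra_simps)
  have e0: "cross2 ?v (x - a) = 0" if "x \<in> ?e" for x
  proof -
    obtain s where x: "x = (1 - s) *\<^sub>R a + s *\<^sub>R b" using \<open>x \<in> ?e\<close> unfolding closed_segment_def by blast
    show ?thesis unfolding x by (simp add: cross2_def algebra_simps)
  qed
  have "norm (J *v ?v) = norm ?v"
    by (rule power2_eq_imp_eq) (simp_all add: norm_pt_sq J_nth power2_commute)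
  then have "norm ?n = 1" using v by simp
  moreover have "?n \<bullet> (z - x) \<le> 0" if "x \<in> ?e" "z \<in> ?K" for x z
    using that e0 mem_triangle_iff[OF assms] v by (simp add: Jin divide_nonneg_pos)
  ultimately show "norm ?n = 1 \<and> (\<forall>x\<in>?e. \<forall>z\<in>?e. ?n \<bullet> (z - x) = 0) \<and> (\<forall>x\<in>?e. \<forall>z\<in>?K. ?n \<bullet> (z - x) \<le> 0)"
    by (auto simp: Jin e0)
  fix n assume n: "norm n = 1 \<and> (\<forall>x\<in>?e. \<forall>z\<in>?e. n \<bullet> (z - x) = 0) \<and> (\<forall>x\<in>?e. \<forall>z\<in>?K. n \<bullet> (z - x) \<le> 0)"
  have "c \<in> ?K" by (simp add: hull_inc)
  then have n0: "n \<bullet> ?v = 0" and nc: "n \<bullet> (c - a) \<le> 0" using n by auto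
  define l where "l = (n \<bullet> (J *v ?v)) / (norm ?v)\<^sup>2"
  \<comment> \<open>Expansion of \<open>n\<close> in the orthogonal basis \<open>?v\<close>,
    \<open>J *v ?v\<close>, whose members have equal length.\<close>
  have "(norm ?v)\<^sup>2 *\<^sub>R n = (n \<bullet> ?v) *\<^sub>R ?v + (n \<bullet> (J *v ?v)) *\<^sub>R (J *v ?v)"
    by (simp only: norm_pt_sq inner_pt pt_eq_iff J_nth, simp add: algebra_simps J_nth power2_eq_square)
  then have "(1 / (norm ?v)\<^sup>2) *\<^sub>R ((norm ?v)\<^sup>2 *\<^sub>R n) = l *\<^sub>R (J *v ?v)"
    by (simp add: n0 l_def)
  then have nl: "n = l *\<^sub>R (J *v ?v)" using v by simp
  have "l * - cross2 ?v (c - a) \<le> 0"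
    using nc Jin[of c a] unfolding nl by (simp add: cross2_def)
  then have "l \<ge> 0" using assms by (simp add: ccw_def zero_le_mult_iff)
  moreover have "\<bar>l\<bar> * norm ?v = 1" using n \<open>norm (J *v ?v) = norm ?v\<close> unfolding nl by simp
  ultimately have "l = 1 / norm ?v" using v by (simp add: field_simps)
  then show "n = ?n" using nl by simp
qed

lemma tangent_triangle:
  assumes "ccw a b c"
  shows "tangent (convex hull {a, b, c}) (closed_segment a b) = (1 / norm (b - a)) *\<^sub>R (b - a)"
  unfolding tangent_def outward_normal_triangle[OF assms]
  by (simp add: pt_eq_iff J_nth matrix_vector_mult_scaleR minus_divide_left)

lemma ccw_edge_obtain:
  assumes "2 simplex K" "e edge_of K"
  obtains a b c where "K = convex hull {a, b, c}" "ccw a b c" "e = closed_segment a b"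
proof -
  obtain a b c where abc: "K = convex hull {a, b, c}" "ccw a b c"
    using simplex_2_obtain_ccw'[OF assms(1)] by metis
  then have "e = closed_segment a b \<or> e = closed_segment b c \<or> e = closed_segment c a"
    using edges_triangle[of a b c] assms(2) by blast
  moreover have "ccw b c a" "ccw c a b" using abc(2) ccw_rotate by blast+
  moreover have "{b, c, a} = {a, b, c}" "{c, a, b} = {a, b, c}" by auto
  ultimately show ?thesis using that abc by metis
qed

text \<open>The endpoints of a segment are determined only up to order, so the tangent is determined
  up to sign; quadratic forms in it do not notice.\<close>

lemma tangent_edge:
  assumes "2 simplex K" "e edge_of K" "e = closed_segment a b"
  shows "tangent K e = (1 / norm (b - a)) *\<^sub>R (b - a) \<or> tangent K e = - ((1 / norm (b - a)) *\<^sub>R (b - a))"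
    and "a \<noteq> b"
proof -
  obtain a' b' c where K: "K = convex hull {a', b', c}" "ccw a' b' c" "e = closed_segment a' b'"
    using ccw_edge_obtain[OF assms(1,2)] by metis
  then have "{a', b'} = {a, b}" using assms(3) by (simp add: closed_segment_eq)
  then have "a' = a \<and> b' = b \<or> a' = b \<and> b' = a" by (auto simp: doubleton_eq_iff)
  then show "tangent K e = (1 / norm (b - a)) *\<^sub>R (b - a) \<or> tangent K e = - ((1 / norm (b - a)) *\<^sub>R (b - a))"
    using tangent_triangle[OF K(2)] K(1,3)
    by (auto simp: norm_minus_commute scaleR_right_diff_distrib)
  show "a \<noteq> b" using \<open>{a', b'} = {a, b}\<close> ccw_distinct[OF K(2)] by auto
qed

section \<open>Relative position of triangles with a common edge\<close>

lemma midpoint_cross2_pos: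
  assumes "ccw a b c"
  shows "0 < cross2 (c - b) (midpoint a b - b)" "0 < cross2 (a - c) (midpoint a b - c)"
    "cross2 (b - a) (midpoint a b - a) = 0"
  using assms by (auto simp: ccw_def cross2_def midpoint_def algebra_simps field_simps)

text \<open>The midpoint of the common edge satisfies the conditions of the other four sides
  strictly, and they survive a small move towards \<open>c\<close>. That move also makes the
  condition of the common edge strict, for both triangles at once.\<close>

lemma interiors_meet_of_same_side:
  assumes "ccw a b c" "ccw a b d"
  shows "interior (convex hull {a, b, c}) \<inter> interior (convex hull {a, b, d}) \<noteq> {}"
proof -
  let ?m = "midpoint a b"
  define f where "f t = ?m + t *\<^sub>R (c - ?m)" for t :: real
  let ?S = "{t. 0 < cross2 (c - b) (f t - b)} \<inter> {t. 0 < cross2 (a - c) (f t - c)}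
     \<inter> {t. 0 < cross2 (d - b) (f t - b)} \<inter> {t. 0 < cross2 (a - d) (f t - d)}"
  have "continuous_on UNIV f" unfolding f_def by (intro continuous_intros)
  then have "open {t. 0 < cross2 u (f t - v)}" for u v
    by (rule open_Collect_less[of "\<lambda>_. 0" "\<lambda>t. cross2 u (f t - v)",
          OF continuous_on_const continuous_on_cross2])
  then have "open ?S" by (intro open_Int)
  moreover have "0 \<in> ?S" using midpoint_cross2_pos[OF assms(1)] midpoint_cross2_pos[OF assms(2)] by (simp add: f_def)
  ultimately obtain r where r: "r > 0" "ball 0 r \<subseteq> ?S" unfolding open_contains_ball by blast
  then have t: "r / 2 \<in> ?S" by (auto simp: subset_iff)
  have "cross2 (b - a) (f (r / 2) - a) = r / 2 * cross2 (b - a) (c - a)"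
    by (simp add: cross2_def f_def midpoint_def algebra_simps) (simp add: field_simps)
  moreover have "0 < r / 2 * cross2 (b - a) (c - a)" using r assms by (simp add: ccw_def)
  ultimately have "0 < cross2 (b - a) (f (r / 2) - a)" by simp
  then have "f (r / 2) \<in> interior (convex hull {a, b, c})" "f (r / 2) \<in> interior (convex hull {a, b, d})"
    using t assms by (auto intro!: mem_interior_triangleI)
  then show ?thesis by blast
qed

text \<open>The half-planes of the four outer sides form an open neighbourhood of the midpoint. A
  point of it belongs to one triangle or the other, according to its side of the line through
  \<open>a\<close> and \<open>b\<close>.\<close>

lemma midpoint_interior_of_opposite_sides:
  assumes "ccw a b c" "ccw b a d"
  shows "midpoint a b \<in> interior (convex hull {a, b, c} \<union> convex hull {b, a, d})"
proof (rule interiorI)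
  let ?S = "{x. 0 < cross2 (c - b) (x - b)} \<inter> {x. 0 < cross2 (a - c) (x - c)}
     \<inter> {x. 0 < cross2 (d - a) (x - a)} \<inter> {x. 0 < cross2 (b - d) (x - d)}"
  show "open ?S" by (intro open_Int open_cross2_pos)
  show "midpoint a b \<in> ?S"
    using midpoint_cross2_pos[OF assms(1)] midpoint_cross2_pos[OF assms(2)] by (simp add: midpoint_sym)
  have "cross2 (a - b) (x - b) = - cross2 (b - a) (x - a)" for x
    by (simp add: cross2_def algebra_simps)
  then show "?S \<subseteq> convex hull {a, b, c} \<union> convex hull {b, a, d}"
    using mem_triangle_iff[OF assms(1)] mem_triangle_iff[OF assms(2)] by force
qed

text \<open>The intersection is a face of each triangle, and a face that meets the interior is the
  whole triangle.\<close>

lemma triangulation_interiors_disjoint: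
  assumes "triangulation \<T>" "K \<in> \<T>" "L \<in> \<T>" "interior K \<inter> interior L \<noteq> {}"
  shows "K = L"
proof -
  have "K' \<subseteq> L'" if "K' \<in> \<T>" "L' \<in> \<T>" "interior K' \<inter> interior L' \<noteq> {}" for K' L'
  proof -
    have "(K' \<inter> L') face_of K'" using assms(1) that by (simp add: triangulation_def)
    moreover have "(K' \<inter> L') \<inter> interior K' \<noteq> {}"
      using that(3) interior_subset[of K'] interior_subset[of L'] by blast
    ultimately have "K' \<inter> L' = K'" using face_of_disjoint_interior by blast
    then show ?thesis by blast
  qed
  from this[of K L] this[of L K] assms show ?thesis by (simp add: Int_commute subset_antisym)
qed

text \<open>Two triangles sharing an edge lie on opposite sides of it, so the midpoint of the edge is
  interior to their union; this is where the exclusion of slit domains enters.\<close>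
lemma boundary_edge_unique_triangle:
  assumes \<Omega>: "polygonal_domain \<Omega>" and \<T>: "triangulation_of \<Omega> \<T>"
    and K: "K \<in> \<T>" "L \<in> \<T>" "e edge_of K" "e edge_of L" and e: "e \<subseteq> frontier \<Omega>"
  shows "K = L"
proof (rule ccontr)
  assume ne: "K \<noteq> L"
  have spx: "2 simplex K" "2 simplex L" and tri: "triangulation \<T>" and cl: "\<Union>\<T> = closure \<Omega>"
    using \<T> K by (auto simp: triangulation_of_def)
  obtain a b c where 1: "K = convex hull {a, b, c}" "ccw a b c" "e = closed_segment a b"
    using ccw_edge_obtain[OF spx(1) K(3)] by metis
  obtain a' b' d where 2: "L = convex hull {a', b', d}" "ccw a' b' d" "e = closed_segment a' b'"
    using ccw_edge_obtain[OF spx(2) K(4)] by metis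
  have "{a', b'} = {a, b}" using 1(3) 2(3) by (simp add: closed_segment_eq)
  then consider "a' = a" "b' = b" | "a' = b" "b' = a" by (auto simp: doubleton_eq_iff)
  then show False
  proof cases
    case 1
    then show False
      using interiors_meet_of_same_side triangulation_interiors_disjoint[OF tri K(1,2)] ne
        \<open>K = convex hull {a, b, c}\<close> \<open>ccw a b c\<close> 2 by metis
  next
    case 2
    then have "midpoint a b \<in> interior (K \<union> L)"
      using midpoint_interior_of_opposite_sides[of a b c d] 1 \<open>ccw a' b' d\<close> \<open>L = convex hull {a', b', d}\<close> by simp
    moreover have "interior (K \<union> L) \<subseteq> interior (closure \<Omega>)"
      using K cl by (intro interior_mono) blast
    ultimately have "midpoint a b \<in> \<Omega>" "open \<Omega>" using \<Omega> by (auto simp: polygonal_domain_def)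
    moreover have "midpoint a b \<in> frontier \<Omega>"
      using e 1(3) midpoint_in_closed_segment[of a b] by blast
    ultimately show False by (simp add: frontier_def interior_open)
  qed
qed

section \<open>Traces and integrals of piecewise constant fields\<close>

text \<open>Every average, not only the limit, equals \<open>A\<close>. Convexity enters because it
  puts \<open>x\<close> in the closure of the interior, so that the sets averaged over have positive
  measure.\<close>

lemma boundary_trace_const:
  fixes f :: "pt \<Rightarrow> 'a::euclidean_space"
  assumes K: "convex K" "interior K \<noteq> {}" "x \<in> K"
    and f: "AE z in lebesgue. z \<in> interior K \<longrightarrow> f z = A"
  shows "boundary_trace K f x = A"
proof -
  have avg: "(1 / measure lebesgue (interior K \<inter> ball x r)) *\<^sub>R
      (LINT z:(interior K \<inter> ball x r)|lebesgue. f z) = A" if r: "r > 0" for r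
  proof -
    define S where "S = interior K \<inter> ball x r"
    have "x \<in> closure (interior K)"
      using convex_closure_interior[OF K(1,2)] K(3) closure_subset by blast
    then obtain z where "z \<in> interior K" "dist z x < r"
      using r unfolding closure_approachable by blast
    then have "S \<noteq> {}" unfolding S_def by (auto simp: dist_commute)
    moreover have S: "open S" unfolding S_def by auto
    moreover have "S \<in> lmeasurable"
      unfolding S_def using S by (intro lmeasurable_open) (auto simp: S_def bounded_Int)
    ultimately have pos: "measure lebesgue S \<noteq> 0"
      using open_not_negligible negligible_iff_measure0 by blast
    have m: "(\<lambda>z. indicator S z *\<^sub>R A) \<in> borel_measurable lebesgue"
      using S by (intro borel_measurable_scaleR borel_measurable_indicator) auto
    have ae: "AE z in lebesgue. indicator S z *\<^sub>R A = indicator S z *\<^sub>R f z"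
      using f by eventually_elim (auto simp: S_def indicator_def)
    then have ae2: "AE z in lebesgue. indicator S z *\<^sub>R f z = indicator S z *\<^sub>R A"
      by eventually_elim (rule sym)
    have "(LINT z:S|lebesgue. f z) = (LINT z:S|lebesgue. A)"
      unfolding set_lebesgue_integral_def
      by (rule integral_cong_AE[OF borel_measurable_AE[OF m ae] m ae2])
    also have "\<dots> = measure lebesgue S *\<^sub>R A"
      using \<open>S \<in> lmeasurable\<close> by (intro set_integral_const) (auto simp: fmeasurable_def)
    finally show ?thesis using pos by (simp add: S_def)
  qed
  have "((\<lambda>r. (1 / measure lebesgue (interior K \<inter> ball x r)) *\<^sub>R
      (LINT z:(interior K \<inter> ball x r)|lebesgue. f z)) \<longlongrightarrow> A) (at_right 0)"
    by (rule tendsto_eventually) (use avg in \<open>auto simp: eventually_at_right_less eventually_at_topological intro: eventually_at_rightI[of 0 1]\<close>)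
  then show ?thesis unfolding boundary_trace_def by (intro tendsto_Lim) auto
qed

lemma boundary_trace_weak_gradient:
  assumes K: "convex K" "interior K \<noteq> {}" "x \<in> K"
    and v: "\<And>z. z \<in> interior K \<Longrightarrow> v z = k + c \<bullet> z"
  shows "boundary_trace K (\<lambda>z. \<chi> i. weak_partial (interior K) i v z) x = c"
proof (rule boundary_trace_const[OF K])
  have "AE z in lebesgue. \<forall>i. z \<in> interior K \<longrightarrow> weak_partial (interior K) i v z = c $ i"
    unfolding AE_all_countable using v by (intro allI weak_partial_affine) auto
  then show "AE z in lebesgue. z \<in> interior K \<longrightarrow> (\<chi> i. weak_partial (interior K) i v z) = c"
    by eventually_elim (auto simp: vec_eq_iff)
qed

text \<open>The second derivatives vanish because the first are constant almost everywhere, the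
  Christoffel symbols because the metric coefficients are constant.\<close>

lemma AE_hess_eq_0:
  assumes v: "\<And>z. z \<in> interior K \<Longrightarrow> v z = k + c \<bullet> z"
    and g: "\<And>z. z \<in> interior K \<Longrightarrow> g z = A"
  shows "AE x in lebesgue. x \<in> interior K \<longrightarrow> hess (interior K) g v x = 0"
proof -
  let ?U = "interior K"
  have U: "open ?U" by simp
  have "AE x in lebesgue. x \<in> ?U \<longrightarrow> weak_partial ?U j v x = c $ j" for j
    using v by (intro weak_partial_affine) auto
  then have 1: "AE x in lebesgue. \<forall>i j. x \<in> ?U \<longrightarrow> weak_partial ?U i (weak_partial ?U j v) x = 0"
    unfolding AE_all_countable by (intro allI weak_partial_const[OF U])
  have 2: "AE x in lebesgue. \<forall>i k l. x \<in> ?U \<longrightarrow> weak_partial ?U i (\<lambda>z. g z $ k $ l) x = 0"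
    unfolding AE_all_countable
    using g by (intro allI weak_partial_const[OF U]) auto
  from 1 2 show ?thesis
    by eventually_elim (auto simp: vec_eq_iff hess_def christoffel_def)
qed

lemma inner_K_hess_eq_0:
  assumes v: "\<And>z. z \<in> interior K \<Longrightarrow> v z = k + c \<bullet> z"
    and g: "\<And>z. z \<in> interior K \<Longrightarrow> g z = A"
  shows "inner_K g K \<rho> (hess (interior K) g v) = 0"
  unfolding inner_K_def set_lebesgue_integral_def
proof (rule integral_eq_zero_AE)
  have "trace (B ** 0 :: mat2) = 0" for B :: mat2
    by (simp add: trace_def matrix_matrix_mult_def)
  moreover have "AE x in lebesgue. x \<in> interior K \<longrightarrow> hess (interior K) g v x = 0"
    using v g by (rule AE_hess_eq_0)
  ultimately show "AE x in lebesgue. indicator (interior K) x *\<^sub>R (trace (matrix_inv (g x) ** \<rho> x **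
      matrix_inv (g x) ** hess (interior K) g v x) * sqrt (det (g x))) = 0"
    by (auto simp: indicator_def elim!: eventually_mono)
qed

text \<open>The endpoints chosen in \<open>edge_integral\<close> may come in either order; their
  distance is the same.\<close>

lemma edge_integral_const:
  assumes e: "e = closed_segment a b" and f: "\<And>x. x \<in> e \<Longrightarrow> f x = s"
  shows "edge_integral e f = dist a b * s"
proof -
  obtain a' b' where ab: "(SOME (a, b). e = closed_segment a b) = (a', b')" by fastforce
  have e': "e = closed_segment a' b'"
    using someI_ex[of "\<lambda>(a, b). e = closed_segment a b"] e ab by auto
  then have "{a', b'} = {a, b}" using e by (simp add: closed_segment_eq)
  then have d: "dist a' b' = dist a b" by (auto simp: doubleton_eq_iff dist_commute)
  have f': "f (a' + t *\<^sub>R (b' - a')) = s" if "t \<in> {0..1}" for t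
  proof (rule f)
    show "a' + t *\<^sub>R (b' - a') \<in> e"
      using that unfolding e' closed_segment_def by (auto simp: algebra_simps intro!: exI[of _ t])
  qed
  have "(LINT t:{0..1}|lebesgue. f (a' + t *\<^sub>R (b' - a'))) = (LINT t:{0..1::real}|lebesgue. s)"
    unfolding set_lebesgue_integral_def
    by (rule Bochner_Integration.integral_cong) (use f' in \<open>auto simp: indicator_def\<close>)
  also have "\<dots> = s" by (subst set_integral_const) auto
  finally show ?thesis using ab d by (simp add: edge_integral_def)
qed

section \<open>The contribution of one triangle\<close>

text \<open>The integrand on an edge seen from one triangle. Of the factors
  \<open>sqrt (\<tau> \<bullet> (A *v \<tau>))\<close>, the one in the normal cancels the one in the
  length density, and the two in the tangential component make up the denominator.\<close>

definition edge_term :: "pt set \<Rightarrow> mat2 \<Rightarrow> mat2 \<Rightarrow> pt \<Rightarrow> pt set \<Rightarrow> real" where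
  "edge_term K A S c e = (let \<tau> = tangent K e in
     (\<tau> \<bullet> (S *v \<tau>)) / (\<tau> \<bullet> (A *v \<tau>)) * ((J *v (A *v \<tau>)) \<bullet> c) / sqrt (det A))"

lemma Sym_iff: "A \<in> Sym \<longleftrightarrow> A $ 2 $ 1 = A $ 1 $ 2"
  by (auto simp: Sym_def vec_eq_iff forall_2 transpose_def)

lemma inner_mat2: "x \<bullet> (A *v y) = A $ 1 $ 1 * x $ 1 * y $ 1 + A $ 1 $ 2 * x $ 1 * y $ 2
    + A $ 2 $ 1 * x $ 2 * y $ 1 + A $ 2 $ 2 * x $ 2 * y $ 2" for x y :: pt
  by (simp add: inner_pt matrix_vector_mult_def sum_2 algebra_simps)

text \<open>The Gram determinant: \<open>det (P\<^sup>T A P) = det A (det P)\<^sup>2\<close> for the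
  matrix \<open>P\<close> with columns \<open>u\<close> and \<open>w\<close>.\<close>

lemma Gram_det:
  assumes "A \<in> Sym"
  shows "(u \<bullet> (A *v u)) * (w \<bullet> (A *v w)) - (u \<bullet> (A *v w))\<^sup>2 = det A * (cross2 u w)\<^sup>2"
  using assms unfolding Sym_iff inner_mat2 det_2 cross2_def by (simp add: algebra_simps power2_eq_square)

lemma pos_def_det:
  assumes "pos_def A" shows "0 < det A"
proof -
  have A: "A \<in> Sym" "\<And>u. u \<noteq> 0 \<Longrightarrow> 0 < u \<bullet> (A *v u)" using assms by (auto simp: pos_def_def)
  define u :: pt where "u = vector [1, 0]"
  \<comment> \<open>The vector orthogonal to \<open>u\<close> in the form given by \<open>A\<close>,
    scaled to avoid division; its energy is \<open>A $ 1 $ 1 * det A\<close>.\<close>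
  define w :: pt where "w = vector [- A $ 1 $ 2, A $ 1 $ 1]"
  have "u \<noteq> 0" by (simp add: u_def pt_eq_iff)
  then have a: "0 < A $ 1 $ 1" using A(2)[of u] by (simp add: inner_mat2 u_def)
  then have "w \<noteq> 0" by (simp add: w_def pt_eq_iff)
  then have "0 < w \<bullet> (A *v w)" by (rule A(2))
  also have "w \<bullet> (A *v w) = A $ 1 $ 1 * det A"
    using A(1) by (simp add: inner_mat2 w_def det_2 Sym_iff algebra_simps)
  finally show ?thesis using a by (simp add: zero_less_mult_iff)
qed

text \<open>Cramer's rule for the gradient of an affine function that drops by 1 along both edges
  leaving a vertex, as the hat function does.\<close>

lemma triangle_gradient:
  assumes "c \<bullet> u = -1" "c \<bullet> w = -1"
  shows "cross2 u w *\<^sub>R c = J *v (u - w)"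
proof -
  have *: "c $ 1 * u $ 1 + c $ 2 * u $ 2 = -1" "c $ 1 * w $ 1 + c $ 2 * w $ 2 = -1"
    using assms by (auto simp: inner_pt)
  have "cross2 u w * c $ 1 = u $ 2 - w $ 2" "cross2 u w * c $ 2 = w $ 1 - u $ 1"
    using * unfolding cross2_def by algebra+
  then show ?thesis by (simp add: pt_eq_iff J_nth)
qed

lemma inner_J_J: "(J *v x) \<bullet> (J *v y) = x \<bullet> y"
  by (simp add: inner_pt J_nth)

text \<open>Homogeneity of degree one in the tangent: the edge length absorbs the normalisation and
  only the edge vector is left.\<close>

lemma edge_term_triangle:
  assumes "ccw a b c"
  shows "edge_integral (closed_segment a b) (\<lambda>_. 1) * edge_term (convex hull {a, b, c}) A S d (closed_segment a b) =
    ((b - a) \<bullet> (S *v (b - a))) / ((b - a) \<bullet> (A *v (b - a))) * ((J *v (A *v (b - a))) \<bullet> d) / sqrt (det A)"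
proof -
  have "norm (b - a) \<noteq> 0" using ccw_distinct[OF assms] by auto
  moreover have "edge_integral (closed_segment a b) (\<lambda>_. 1) = norm (b - a)"
    using edge_integral_const[of "closed_segment a b" a b "\<lambda>_. 1" 1] by (simp add: dist_norm norm_minus_commute)
  ultimately show ?thesis
    by (simp add: edge_term_def tangent_triangle[OF assms] Let_def matrix_vector_mult_scaleR)
qed

text \<open>On the edge opposite to \<open>p\<close> the conormal factor is minus the energy of
  \<open>w - u\<close>, which cancels the denominator. Polarisation of the remaining
  \<open>s (w - u)\<close> produces the mixed term and removes the pure terms left by the other two
  edges.\<close>

lemma sum_edge_terms:
  fixes p a b c :: pt
  defines "u \<equiv> a - p" and "w \<equiv> b - p"
  assumes ccw: "ccw p a b" and A: "pos_def A" and S: "S \<in> Sym"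
    and c: "c \<bullet> u = -1" "c \<bullet> w = -1"
  shows "(\<Sum>e | e edge_of (convex hull {p, a, b}). edge_integral e (\<lambda>_. 1) * edge_term (convex hull {p, a, b}) A S c e) =
    (2 * (u \<bullet> (S *v w)) - (u \<bullet> (A *v w)) *
      ((u \<bullet> (S *v u)) / (u \<bullet> (A *v u)) + (w \<bullet> (S *v w)) / (w \<bullet> (A *v w)))) / (sqrt (det A) * cross2 u w)"
proof -
  let ?K = "convex hull {p, a, b}"
  define D where "D = cross2 u w"
  have D: "D > 0" using ccw by (simp add: ccw_def D_def u_def w_def)
  have Asym: "A \<in> Sym" and pos: "x \<noteq> 0 \<Longrightarrow> 0 < x \<bullet> (A *v x)" for x using A by (auto simp: pos_def_def)
  have ne: "u \<noteq> 0" "w \<noteq> 0" "w - u \<noteq> 0" using ccw_distinct[OF ccw] by (auto simp: u_def w_def)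
  define q where "q x = x \<bullet> (A *v x)" for x
  define s where "s x = x \<bullet> (S *v x)" for x
  have q: "0 < q u" "0 < q w" "0 < q (w - u)" using pos ne by (auto simp: q_def)
  \<comment> \<open>Both the conormal and the gradient carry a factor \<open>J\<close>, and
    \<open>J\<close> preserves inner products.\<close>
  have Jc: "(J *v (A *v x)) \<bullet> c = (x \<bullet> (A *v (u - w))) / D" for x
  proof -
    have "D * ((J *v (A *v x)) \<bullet> c) = (A *v x) \<bullet> (u - w)"
      using triangle_gradient[OF c] inner_J_J[of "A *v x" "u - w"] by (metis D_def inner_scaleR_right)
    also have "\<dots> = x \<bullet> (A *v (u - w))"
      using Asym by (simp add: inner_commute[of "A *v x"] inner_mat2 Sym_iff algebra_simps)
    finally show ?thesis using D by (simp add: field_simps)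
  qed
  have rot: "{a, b, p} = {p, a, b}" "{b, p, a} = {p, a, b}" "ccw a b p" "ccw b p a"
    using ccw ccw_rotate by blast+
  define T where "T x = s x / q x * (x \<bullet> (A *v (u - w))) / (sqrt (det A) * D)" for x
  have T1: "edge_integral (closed_segment p a) (\<lambda>_. 1) * edge_term ?K A S c (closed_segment p a) = T u"
    using edge_term_triangle[OF ccw, of A S c] by (simp add: Jc T_def s_def q_def u_def ac_simps)
  have T2: "edge_integral (closed_segment a b) (\<lambda>_. 1) * edge_term ?K A S c (closed_segment a b) = T (w - u)"
    using edge_term_triangle[OF rot(3), of A S c] by (simp add: rot Jc T_def s_def q_def u_def w_def ac_simps)
  have T3: "edge_integral (closed_segment b p) (\<lambda>_. 1) * edge_term ?K A S c (closed_segment b p) = T (p - b)"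
    using edge_term_triangle[OF rot(4), of A S c] by (simp add: rot Jc T_def s_def q_def ac_simps)
  have "p - b = - w" by (simp add: w_def)
  have d: "closed_segment p a \<noteq> closed_segment a b" "closed_segment p a \<noteq> closed_segment b p"
    "closed_segment a b \<noteq> closed_segment b p"
    using ccw_distinct[OF ccw] by (auto simp: closed_segment_eq doubleton_eq_iff)
  have "(\<Sum>e | e edge_of ?K. edge_integral e (\<lambda>_. 1) * edge_term ?K A S c e) = T u + T (w - u) + T (p - b)"
    unfolding edges_triangle[OF ccw] using d by (simp add: T1 T2 T3)
  also have "\<dots> = (s u / q u * (q u - u \<bullet> (A *v w)) - s (w - u) + s w / q w * (q w - u \<bullet> (A *v w))) / (sqrt (det A) * D)"
  proof -
    have e1: "u \<bullet> (A *v (u - w)) = q u - u \<bullet> (A *v w)"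
      by (simp add: q_def inner_mat2 algebra_simps)
    have e2: "(w - u) \<bullet> (A *v (u - w)) = - q (w - u)"
      by (simp add: q_def inner_mat2 algebra_simps)
    have e3: "(- w) \<bullet> (A *v (u - w)) = q w - u \<bullet> (A *v w)"
      using Asym by (simp add: q_def inner_mat2 Sym_iff algebra_simps)
    have e4: "q (- w) = q w" "s (- w) = s w" by (simp_all add: q_def s_def inner_mat2)
    show ?thesis
      unfolding \<open>p - b = - w\<close> T_def e1 e2 e3 e4 using q(3)
      by (simp add: add_divide_distrib diff_divide_distrib)
  qed
  also have "s u / q u * (q u - u \<bullet> (A *v w)) = s u - (u \<bullet> (A *v w)) * (s u / q u)"
    using q(1) by (simp add: right_diff_distrib)
  also have "s w / q w * (q w - u \<bullet> (A *v w)) = s w - (u \<bullet> (A *v w)) * (s w / q w)"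
    using q(2) by (simp add: right_diff_distrib)
  also have "s (w - u) = s u + s w - 2 * (u \<bullet> (S *v w))"
    using S by (simp add: s_def inner_mat2 Sym_iff algebra_simps)
  finally show ?thesis by (simp add: s_def q_def D_def algebra_simps)
qed

text \<open>The Gram identity does two things: it bounds the cosine strictly by 1, where
  \<open>arccos\<close> is differentiable, and it evaluates the sine as
  \<open>sqrt (det A) * D / r\<close>, the source of the denominator.\<close>

lemma angle_derivative:
  assumes A: "pos_def A" and D: "0 < cross2 u w"
  shows "((\<lambda>t. arccos ((u \<bullet> ((A + t *\<^sub>R S) *v w)) /
        (sqrt (u \<bullet> ((A + t *\<^sub>R S) *v u)) * sqrt (w \<bullet> ((A + t *\<^sub>R S) *v w)))))
    has_real_derivative
      - (1 / 2) * ((2 * (u \<bullet> (S *v w)) - (u \<bullet> (A *v w)) *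
        ((u \<bullet> (S *v u)) / (u \<bullet> (A *v u)) + (w \<bullet> (S *v w)) / (w \<bullet> (A *v w)))) / (sqrt (det A) * cross2 u w))) (at 0)"
proof -
  define m p q where mpq: "m = u \<bullet> (A *v w)" "p = u \<bullet> (A *v u)" "q = w \<bullet> (A *v w)"
  define m' p' q' where mpq': "m' = u \<bullet> (S *v w)" "p' = u \<bullet> (S *v u)" "q' = w \<bullet> (S *v w)"
  have lin: "x \<bullet> ((A + t *\<^sub>R S) *v y) = x \<bullet> (A *v y) + t * (x \<bullet> (S *v y))" for x y t
    by (simp add: inner_mat2 algebra_simps)
  have "u \<noteq> 0" "w \<noteq> 0" using D by (auto simp: cross2_def)
  then have pq: "p > 0" "q > 0" using A by (auto simp: mpq pos_def_def)
  have det: "det A > 0" by (rule pos_def_det[OF A])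
  define D where "D = cross2 u w"
  have D: "D > 0" using assms by (simp add: D_def)
  have gram: "p * q - m\<^sup>2 = det A * D\<^sup>2"
    using Gram_det[of A u w] A by (simp add: mpq D_def pos_def_def)
  define r where "r = sqrt p * sqrt q"
  have r: "r > 0" "r\<^sup>2 = p * q" using pq by (auto simp: r_def power_mult_distrib)
  have "0 < det A * D\<^sup>2" using det D by simp
  then have "\<bar>m\<bar>\<^sup>2 < r\<^sup>2" using gram r(2) by simp
  then have "\<bar>m\<bar> < r" by (rule power2_less_imp_less) (use r(1) in simp)
  then have "- r < m" "m < r" by linarith+
  then have bd: "-1 < m / r" "m / r < 1" using r(1) by (simp_all add: pos_less_divide_eq pos_divide_less_eq)
  have sq: "sqrt (1 - (m / r)\<^sup>2) = sqrt (det A) * D / r"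
  proof -
    have "1 - (m / r)\<^sup>2 = (r\<^sup>2 - m\<^sup>2) / r\<^sup>2"
      using r(1) by (simp add: power_divide diff_divide_distrib)
    also have "r\<^sup>2 - m\<^sup>2 = det A * D\<^sup>2" using gram r(2) by simp
    finally show ?thesis using D r(1) by (simp add: real_sqrt_divide real_sqrt_mult)
  qed
  define f where "f t = (m + t * m') / (sqrt (p + t * p') * sqrt (q + t * q'))" for t
  \<comment> \<open>Logarithmic differentiation of the two square roots in the denominator gives the
    halves of \<open>p' / p\<close> and \<open>q' / q\<close>.\<close>
  define f' where "f' = (m' - m / 2 * (p' / p + q' / q)) / r"
  have df: "(f has_real_derivative f') (at 0)"
  proof -
    have sp: "((\<lambda>t. sqrt (p + t * p')) has_real_derivative p' / (2 * sqrt p)) (at 0)"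
      using pq by (auto intro!: derivative_eq_intros simp: field_simps)
    have sqd: "((\<lambda>t. sqrt (q + t * q')) has_real_derivative q' / (2 * sqrt q)) (at 0)"
      using pq by (auto intro!: derivative_eq_intros simp: field_simps)
    have N: "((\<lambda>t. m + t * m') has_real_derivative m') (at 0)"
      by (auto intro!: derivative_eq_intros)
    have "(f has_real_derivative (m' * (sqrt p * sqrt q) - m * (p' / (2 * sqrt p) * sqrt q + q' / (2 * sqrt q) * sqrt p)) /
        ((sqrt p * sqrt q) * (sqrt p * sqrt q))) (at 0)"
      using DERIV_divide[OF N DERIV_mult[OF sp sqd]] pq unfolding f_def by simp
    also have "(m' * (sqrt p * sqrt q) - m * (p' / (2 * sqrt p) * sqrt q + q' / (2 * sqrt q) * sqrt p)) /
        ((sqrt p * sqrt q) * (sqrt p * sqrt q)) = f'"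
    proof -
      have "z / (2 * x) * y = z / x\<^sup>2 / 2 * (x * y)" if "x \<noteq> 0" for x y z :: real
        using that by (simp add: power2_eq_square)
      from this[of "sqrt p" p' "sqrt q"] this[of "sqrt q" q' "sqrt p"]
      have "p' / (2 * sqrt p) * sqrt q = p' / p / 2 * r" "q' / (2 * sqrt q) * sqrt p = q' / q / 2 * r"
        using pq by (simp_all add: r_def mult.commute)
      then have "m' * (sqrt p * sqrt q) - m * (p' / (2 * sqrt p) * sqrt q + q' / (2 * sqrt q) * sqrt p)
          = (m' - m / 2 * (p' / p + q' / q)) * r"
        by (simp add: r_def[symmetric] algebra_simps)
      then show ?thesis unfolding f'_def r_def[symmetric] using r(1) by simp
    qed
    finally show ?thesis .
  qed
  have f0: "f 0 = m / r" by (simp add: f_def r_def)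
  have "((\<lambda>t. arccos (f t)) has_real_derivative inverse (- sqrt (1 - (f 0)\<^sup>2)) * f') (at 0)"
    by (rule DERIV_chain2[OF DERIV_arccos df]) (use bd f0 in simp_all)
  also have "inverse (- sqrt (1 - (f 0)\<^sup>2)) * f' = - (1 / 2) * ((2 * m' - m * (p' / p + q' / q)) / (sqrt (det A) * D))"
  proof -
    have "inverse (- (E / r)) * ((m' - m / 2 * X) / r) = - (1 / 2) * ((2 * m' - m * X) / E)"
      if "E \<noteq> 0" for E X
      using that r(1) by (simp add: field_simps)
    moreover have "sqrt (det A) * D \<noteq> 0" using D det by simp
    ultimately show ?thesis unfolding f0 sq f'_def by blast
  qed
  finally show ?thesis unfolding f_def lin mpq mpq' D_def .
qed

lemma const_value_eq:
  assumes "interior K \<noteq> {}" "\<And>x. x \<in> interior K \<Longrightarrow> g x = A"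
  shows "const_value K g = A"
  unfolding const_value_def using assms by (intro the_equality) auto

text \<open>The other two vertices may be named in either order, and symmetry of \<open>B\<close>
  makes the expression insensitive to this, so the description has exactly one solution.\<close>

lemma metric_angle_triangle:
  assumes ccw: "ccw p a b" and g: "\<And>x. x \<in> interior (convex hull {p, a, b}) \<Longrightarrow> g x = B" and B: "B \<in> Sym"
  shows "metric_angle g (convex hull {p, a, b}) p =
    arccos (((a - p) \<bullet> (B *v (b - p))) / (sqrt ((a - p) \<bullet> (B *v (a - p))) * sqrt ((b - p) \<bullet> (B *v (b - p)))))"
    (is "_ = ?ang a b")
proof -
  let ?K = "convex hull {p, a, b}"
  have cv: "const_value ?K g = B" by (rule const_value_eq[OF interior_triangle_nonempty[OF ccw] g])
  have ext: "{q. q extreme_point_of ?K} = {p, a, b}" using extreme_points_triangle[OF ccw] by blast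
  have card: "card {p, a, b} = 3" using ccw_distinct[OF ccw] by simp
  have sym: "?ang x y = ?ang y x" for x y
    using B by (simp add: inner_mat2 Sym_iff algebra_simps)
  show ?thesis
    unfolding metric_angle_def cv Let_def ext
  proof (rule the_equality)
    show "\<exists>x y. {p, a, b} = {p, x, y} \<and> card {p, x, y} = 3 \<and> ?ang a b = ?ang x y"
      using card by blast
    fix \<theta> assume "\<exists>x y. {p, a, b} = {p, x, y} \<and> card {p, x, y} = 3 \<and> \<theta> = ?ang x y"
    then obtain x y where xy: "{p, a, b} = {p, x, y}" "card {p, x, y} = 3" "\<theta> = ?ang x y" by blast
    have "p \<noteq> x" "p \<noteq> y" "x \<noteq> y" using xy(2) by (auto simp: card_insert_if split: if_splits)
    then have "{x, y} = {p, x, y} - {p}" by blast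
    moreover have "{a, b} = {p, a, b} - {p}" using ccw_distinct[OF ccw] by blast
    ultimately have "{a, b} = {x, y}" using xy(1) by simp
    then have "a = x \<and> b = y \<or> a = y \<and> b = x" by (auto simp: doubleton_eq_iff)
    then show "\<theta> = ?ang a b" using xy(3) sym by blast
  qed
qed

section \<open>Regrouping the form by triangles\<close>

lemma Sigma_h_0_const_value:
  assumes \<sigma>: "\<sigma> \<in> Sigma_h 0 \<Omega> \<T>" and K: "K \<in> \<T>" "interior K \<noteq> {}"
  shows "x \<in> interior K \<Longrightarrow> \<sigma> x = const_value K \<sigma>" and "const_value K \<sigma> \<in> Sym"
proof -
  have sym: "\<forall>x\<in>interior K. \<sigma> x \<in> Sym" and "\<forall>i j. \<exists>p\<in>polys 0. \<forall>x\<in>interior K. \<sigma> x $ i $ j = p x"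
    using \<sigma> K by (auto simp: Sigma_h_def)
  then have "\<exists>s. \<forall>x\<in>interior K. \<sigma> x $ i $ j = s" for i j
    by (force simp: polys_def)
  then obtain s where s: "\<And>x i j. x \<in> interior K \<Longrightarrow> \<sigma> x $ i $ j = s i j" by metis
  define A :: mat2 where "A = (\<chi> i j. s i j)"
  have A: "\<sigma> x = A" if "x \<in> interior K" for x using s[OF that] by (simp add: A_def vec_eq_iff)
  have "const_value K \<sigma> = A" by (rule const_value_eq[OF K(2) A])
  then show "x \<in> interior K \<Longrightarrow> \<sigma> x = const_value K \<sigma>" "const_value K \<sigma> \<in> Sym"
    using A sym K(2) by auto
qed

lemma V_h_1_affine:
  assumes "v \<in> V_h 1 \<Omega> \<T>" "K \<in> \<T>"
  obtains k c where "\<And>x. x \<in> K \<Longrightarrow> v x = k + c \<bullet> x"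
proof -
  obtain p where p: "p \<in> polys 1" "\<And>x. x \<in> K \<Longrightarrow> v x = p x"
    using assms by (auto simp: V_h_def)
  then obtain d where "p = (\<lambda>x. \<Sum>a\<le>1. \<Sum>b\<le>1 - a. d a b * (x $ 1) ^ a * (x $ 2) ^ b)"
    by (auto simp: polys_def)
  then have "p x = d 0 0 + vector [d 1 0, d 0 1] \<bullet> x" for x
    by (simp add: inner_pt)
  then show ?thesis using p that by metis
qed

section \<open>Traces at a point of an edge\<close>

context
  fixes K e :: "pt set" and A S :: mat2 and g \<sigma> :: "pt \<Rightarrow> mat2" and x :: pt
  assumes K: "2 simplex K" and e: "e edge_of K" and x: "x \<in> e"
    and g: "\<And>z. z \<in> interior K \<Longrightarrow> g z = A" and \<sigma>: "\<And>z. z \<in> interior K \<Longrightarrow> \<sigma> z = S"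
    and A: "pos_def A"
begin

lemma convex_simplex: "convex K" "interior K \<noteq> {}"
  using simplex_2_obtain_ccw'[OF K] interior_triangle_nonempty convex_convex_hull by metis+

lemma edge_point_mem: "x \<in> K"
  using x edge_of_imp_subset[OF e] by blast

lemma boundary_trace_g: "boundary_trace K g x = A"
  using g by (intro boundary_trace_const convex_simplex edge_point_mem) auto

lemma boundary_trace_\<sigma>: "boundary_trace K \<sigma> x = S"
  using \<sigma> by (intro boundary_trace_const convex_simplex edge_point_mem) auto

lemma tangent_nonzero: "tangent K e \<noteq> 0"
proof -
  obtain a b where "e = closed_segment a b" using ccw_edge_obtain[OF K e] by metis
  from tangent_edge[OF K e this] show ?thesis by auto
qed

lemma tangent_energy_pos: "0 < tangent K e \<bullet> (A *v tangent K e)"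
  using A tangent_nonzero by (simp add: pos_def_def)

lemma tangential_comp_eq:
  "tangential_comp g \<sigma> K e x = (tangent K e \<bullet> (S *v tangent K e)) / (tangent K e \<bullet> (A *v tangent K e))"
  using tangent_energy_pos
  by (simp add: tangential_comp_def Let_def g_tangent_def boundary_trace_g boundary_trace_\<sigma> matrix_vector_mult_scaleR)

lemma length_density_eq: "length_density g K e x = sqrt (tangent K e \<bullet> (A *v tangent K e))"
  by (simp add: length_density_def boundary_trace_g)

text \<open>In the normal derivative the metric cancels its inverse, so the Euclidean gradient
  \<open>c\<close> is paired directly with the conormal; positivity of the determinant makes
  \<open>matrix_inv\<close> a genuine inverse.\<close>

lemma edge_integrand_eq:
  assumes v: "\<And>z. z \<in> K \<Longrightarrow> v z = k + c \<bullet> z"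
  shows "tangential_comp g \<sigma> K e x * normal_deriv g v K e x * length_density g K e x = edge_term K A S c e"
proof -
  let ?\<tau> = "tangent K e"
  have "invertible A" using pos_def_det[OF A] by (simp add: invertible_det_nz)
  then have "A ** matrix_inv A = mat 1"
    unfolding matrix_inv_def invertible_def by (metis (mono_tags, lifting) someI_ex)
  then have "A *v (matrix_inv A *v c) = c" by (simp add: matrix_vector_mul_assoc)
  moreover have "boundary_trace K (\<lambda>z. \<chi> i. weak_partial (interior K) i v z) x = c"
    using v interior_subset[of K] by (intro boundary_trace_weak_gradient convex_simplex edge_point_mem) blast
  ultimately have "normal_deriv g v K e x = ((J *v (A *v ?\<tau>)) \<bullet> c) / (sqrt (?\<tau> \<bullet> (A *v ?\<tau>)) * sqrt (det A))"
    by (simp add: normal_deriv_def Let_def boundary_trace_g g_normal_def)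
  then show ?thesis
    using tangent_energy_pos by (simp add: tangential_comp_eq length_density_eq edge_term_def Let_def)
qed

end

text \<open>On a boundary edge there is only one triangle. On an interior edge the traces are
  constant, so tangential continuity almost everywhere is equality of two numbers; possibly opposite
  tangents give the same quadratic form. It serves for the metric as well as for
  \<open>\<sigma>\<close>.\<close>

lemma energy_agrees:
  assumes \<sigma>: "\<sigma> \<in> Sigma_h 0 \<Omega> \<T>" and \<T>: "triangulation_of \<Omega> \<T>" and \<Omega>: "polygonal_domain \<Omega>"
    and K: "K \<in> \<T>" "L \<in> \<T>" "e edge_of K" "e edge_of L"
  shows "tangent K e \<bullet> (const_value K \<sigma> *v tangent K e) = tangent L e \<bullet> (const_value L \<sigma> *v tangent L e)"
proof (cases "e \<subseteq> frontier \<Omega>")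
  case True
  then show ?thesis using boundary_edge_unique_triangle[OF \<Omega> \<T> K] by simp
next
  case False
  have spx: "2 simplex K" "2 simplex L" using \<T> K by (auto simp: triangulation_of_def)
  have ce: "x \<in> interior M \<Longrightarrow> \<sigma> x = const_value M \<sigma>" if "M \<in> \<T>" "2 simplex M" for M x
    using Sigma_h_0_const_value(1)[OF \<sigma> that(1)] by auto
  obtain a b where ab: "e = closed_segment a b" using ccw_edge_obtain[OF spx(1) K(3)] by metis
  let ?\<tau> = "(1 / norm (b - a)) *\<^sub>R (b - a)"
  have tr: "boundary_trace M \<sigma> (a + t *\<^sub>R (b - a)) = const_value M \<sigma>"
    if M0: "M \<in> \<T>" "2 simplex M" "e edge_of M" "t \<in> {0..1}" for M t
  proof -
    obtain p q r where M: "M = convex hull {p, q, r}" "ccw p q r"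
      using simplex_2_obtain_ccw'[OF M0(2)] by metis
    have "a + t *\<^sub>R (b - a) \<in> e"
      using M0(4) unfolding ab closed_segment_def by (auto simp: algebra_simps intro!: exI[of _ t])
    then have "a + t *\<^sub>R (b - a) \<in> M" using edge_of_imp_subset[OF M0(3)] by blast
    then show ?thesis
      using M ce[OF M0(1,2)] interior_triangle_nonempty[OF M(2)]
      by (intro boundary_trace_const) (auto simp: convex_convex_hull)
  qed
  have "e \<in> interior_edges \<Omega> \<T>" using False K by (auto simp: interior_edges_def edges_def)
  moreover have "tangentially_continuous \<Omega> \<T> \<sigma>" using \<sigma> by (simp add: Sigma_h_def Sigma_space_def)
  ultimately have ae: "AE t in lebesgue_on {0..1}.
      ?\<tau> \<bullet> (boundary_trace K \<sigma> (a + t *\<^sub>R (b - a)) *v ?\<tau>) = ?\<tau> \<bullet> (boundary_trace L \<sigma> (a + t *\<^sub>R (b - a)) *v ?\<tau>)"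
    using K ab unfolding tangentially_continuous_def Let_def by blast
  have "?\<tau> \<bullet> (const_value K \<sigma> *v ?\<tau>) = ?\<tau> \<bullet> (const_value L \<sigma> *v ?\<tau>)"
  proof (rule ccontr)
    assume ne: "?\<tau> \<bullet> (const_value K \<sigma> *v ?\<tau>) \<noteq> ?\<tau> \<bullet> (const_value L \<sigma> *v ?\<tau>)"
    \<comment> \<open>Two different constants would contradict continuity at every parameter of a
      set of measure 1.\<close>
    have "AE t in lebesgue_on {0..1::real}. False"
      by (rule AE_mp[OF ae]) (use ne in \<open>auto simp: tr K spx\<close>)
    then have "emeasure (lebesgue_on {0..1::real}) (space (lebesgue_on {0..1::real})) = 0"
      by (simp add: trivial_limit_def[symmetric] ae_filter_eq_bot_iff)
    then show False by (simp add: emeasure_restrict_space)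
  qed
  moreover have "(- x) \<bullet> (B *v (- x)) = x \<bullet> (B *v x)" for x :: pt and B
    by (simp add: inner_mat2)
  ultimately show ?thesis
    using tangent_edge(1)[OF spx(1) K(3) ab] tangent_edge(1)[OF spx(2) K(4) ab] by metis
qed

lemma single_value_eq:
  assumes "K \<in> \<T>" "e edge_of K" "\<And>L. L \<in> \<T> \<Longrightarrow> e edge_of L \<Longrightarrow> w L e x = w K e x"
  shows "single_value \<T> w e x = w K e x"
  unfolding single_value_def by (rule the_equality; use assms in metis)

lemma b_h_eq_sum_edge_terms:
  assumes \<Omega>: "polygonal_domain \<Omega>" and \<T>: "triangulation_of \<Omega> \<T>"
    and g: "g \<in> Sigma_h_plus 0 \<Omega> \<T>" and \<sigma>: "\<sigma> \<in> Sigma_h 0 \<Omega> \<T>"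
    and v: "\<And>K x. K \<in> \<T> \<Longrightarrow> x \<in> K \<Longrightarrow> v x = k K + c K \<bullet> x"
  shows "b_h \<T> g \<sigma> v = (\<Sum>K\<in>\<T>. \<Sum>e | e edge_of K.
    edge_integral e (\<lambda>_. 1) * edge_term K (const_value K g) (const_value K \<sigma>) (c K) e)"
proof -
  have fin: "finite \<T>" and spx: "\<And>K. K \<in> \<T> \<Longrightarrow> 2 simplex K"
    using \<T> by (auto simp: triangulation_of_def triangulation_def)
  have gh: "g \<in> Sigma_h 0 \<Omega> \<T>" using g by (simp add: Sigma_h_plus_def)
  have tri: "interior K \<noteq> {}" "finite {e. e edge_of K}" if "K \<in> \<T>" for K
  proof -
    obtain p q r where M: "K = convex hull {p, q, r}" "ccw p q r"
      using simplex_2_obtain_ccw'[OF spx[OF \<open>K \<in> \<T>\<close>]] by metis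
    then show "interior K \<noteq> {}" "finite {e. e edge_of K}"
      using interior_triangle_nonempty edges_triangle by auto
  qed
  define A where "A K = const_value K g" for K
  define S where "S K = const_value K \<sigma>" for K
  have gA: "x \<in> interior K \<Longrightarrow> g x = A K" if "K \<in> \<T>" for K x
    unfolding A_def by (rule Sigma_h_0_const_value(1)[OF gh that tri(1)[OF that]])
  have \<sigma>S: "x \<in> interior K \<Longrightarrow> \<sigma> x = S K" if "K \<in> \<T>" for K x
    unfolding S_def by (rule Sigma_h_0_const_value(1)[OF \<sigma> that tri(1)[OF that]])
  have pos: "pos_def (A K)" if "K \<in> \<T>" for K
    using g that tri(1)[OF that] gA[OF that] unfolding Sigma_h_plus_def by force
  have hess0: "inner_K g K (\<lambda>x. S_op (g x) (\<sigma> x)) (hess (interior K) g v) = 0" if "K \<in> \<T>" for K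
    using v[OF that] gA[OF that] interior_subset[of K] by (intro inner_K_hess_eq_0) blast+
  define T where "T K e = edge_term K (A K) (S K) (c K) e" for K e
  have edge: "edge_integral e (\<lambda>x. single_value \<T> (tangential_comp g \<sigma>) e x * jump \<T> (normal_deriv g v) e x *
        single_value \<T> (length_density g) e x) = (\<Sum>K | K \<in> \<T> \<and> e edge_of K. edge_integral e (\<lambda>_. 1) * T K e)"
    if "e \<in> edges \<T>" for e
  proof -
    obtain L where L: "L \<in> \<T>" "e edge_of L" using \<open>e \<in> edges \<T>\<close> by (auto simp: edges_def)
    obtain a b where ab: "e = closed_segment a b" using ccw_edge_obtain[OF spx[OF L(1)] L(2)] by metis
    have "single_value \<T> (tangential_comp g \<sigma>) e x * jump \<T> (normal_deriv g v) e x *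
        single_value \<T> (length_density g) e x = (\<Sum>K | K \<in> \<T> \<and> e edge_of K. T K e)" if x: "x \<in> e" for x
    proof -
      have tc: "tangential_comp g \<sigma> K e x =
          (tangent K e \<bullet> (const_value K \<sigma> *v tangent K e)) / (tangent K e \<bullet> (const_value K g *v tangent K e))"
        and ld: "length_density g K e x = sqrt (tangent K e \<bullet> (const_value K g *v tangent K e))"
        if K: "K \<in> \<T>" "e edge_of K" for K
        unfolding A_def[symmetric] S_def[symmetric]
        by (rule tangential_comp_eq[OF spx[OF K(1)] K(2) x gA[OF K(1)] \<sigma>S[OF K(1)] pos[OF K(1)]]
              length_density_eq[OF spx[OF K(1)] K(2) x gA[OF K(1)] \<sigma>S[OF K(1)] pos[OF K(1)]]; assumption)+
      \<comment> \<open>The common values may be computed from any triangle containing the edge, so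
        each summand of the jump is paired with the values from its own triangle.\<close>
      have sv: "single_value \<T> (tangential_comp g \<sigma>) e x = tangential_comp g \<sigma> K e x"
        "single_value \<T> (length_density g) e x = length_density g K e x"
        if K: "K \<in> \<T>" "e edge_of K" for K
      proof -
        have ag: "tangential_comp g \<sigma> L e x = tangential_comp g \<sigma> K e x"
          "length_density g L e x = length_density g K e x"
          if L: "L \<in> \<T>" "e edge_of L" for L
          unfolding tc[OF K] tc[OF L] ld[OF K] ld[OF L]
          using energy_agrees[OF gh \<T> \<Omega> K(1) L(1) K(2) L(2)] energy_agrees[OF \<sigma> \<T> \<Omega> K(1) L(1) K(2) L(2)]
          by simp_all
        show "single_value \<T> (tangential_comp g \<sigma>) e x = tangential_comp g \<sigma> K e x"
          by (rule single_value_eq[OF K]) (rule ag(1))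
        show "single_value \<T> (length_density g) e x = length_density g K e x"
          by (rule single_value_eq[OF K]) (rule ag(2))
      qed
      have "single_value \<T> (tangential_comp g \<sigma>) e x * jump \<T> (normal_deriv g v) e x * single_value \<T> (length_density g) e x
         = (\<Sum>K | K \<in> \<T> \<and> e edge_of K. single_value \<T> (tangential_comp g \<sigma>) e x * normal_deriv g v K e x * single_value \<T> (length_density g) e x)"
        by (simp add: jump_def sum_distrib_left sum_distrib_right)
      also have "\<dots> = (\<Sum>K | K \<in> \<T> \<and> e edge_of K. T K e)"
      proof (rule sum.cong[OF refl])
        fix K assume "K \<in> {K \<in> \<T>. e edge_of K}"
        then have K: "K \<in> \<T>" "e edge_of K" by auto
        show "single_value \<T> (tangential_comp g \<sigma>) e x * normal_deriv g v K e x * single_value \<T> (length_density g) e x = T K e"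
          unfolding sv[OF K] T_def
          by (rule edge_integrand_eq[OF spx[OF K(1)] K(2) x gA[OF K(1)] \<sigma>S[OF K(1)] pos[OF K(1)] v[OF K(1)]])
      qed
      finally show ?thesis .
    qed
    from edge_integral_const[OF ab this] edge_integral_const[OF ab, of "\<lambda>_. 1" 1]
    show ?thesis by (simp add: sum_distrib_left)
  qed
  have "finite (edges \<T>)"
  proof -
    have "edges \<T> = (\<Union>K\<in>\<T>. {e. e edge_of K})" by (auto simp: edges_def)
    then show ?thesis using fin tri(2) by simp
  qed
  have "b_h \<T> g \<sigma> v = (\<Sum>e\<in>edges \<T>. \<Sum>K | K \<in> \<T> \<and> e edge_of K. edge_integral e (\<lambda>_. 1) * T K e)"
    unfolding b_h_def by (simp add: hess0 cong: sum.cong) (rule sum.cong[OF refl edge])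
  \<comment> \<open>Double counting of the incident pairs of an edge and a triangle.\<close>
  also have "\<dots> = (\<Sum>K\<in>\<T>. \<Sum>e | e \<in> edges \<T> \<and> e edge_of K. edge_integral e (\<lambda>_. 1) * T K e)"
    by (rule sum.swap_restrict[OF \<open>finite (edges \<T>)\<close> fin])
  also have "\<dots> = (\<Sum>K\<in>\<T>. \<Sum>e | e edge_of K. edge_integral e (\<lambda>_. 1) * T K e)"
  proof (rule sum.cong[OF refl])
    fix K assume "K \<in> \<T>"
    then have "{e. e \<in> edges \<T> \<and> e edge_of K} = {e. e edge_of K}" by (auto simp: edges_def)
    then show "(\<Sum>e | e \<in> edges \<T> \<and> e edge_of K. edge_integral e (\<lambda>_. 1) * T K e)
        = (\<Sum>e | e edge_of K. edge_integral e (\<lambda>_. 1) * T K e)" by simp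
  qed
  finally show ?thesis by (simp add: T_def A_def S_def)
qed

lemma metric_angle_derivative:
  assumes ccw: "ccw p a b" and A: "pos_def A" and S: "S \<in> Sym"
    and g: "\<And>x. x \<in> interior (convex hull {p, a, b}) \<Longrightarrow> g x = A"
    and \<sigma>: "\<And>x. x \<in> interior (convex hull {p, a, b}) \<Longrightarrow> \<sigma> x = S"
    and c: "c \<bullet> (a - p) = -1" "c \<bullet> (b - p) = -1"
  shows "((\<lambda>t. metric_angle (\<lambda>x. g x + t *\<^sub>R \<sigma> x) (convex hull {p, a, b}) p) has_real_derivative
    - (1 / 2) * (\<Sum>e | e edge_of (convex hull {p, a, b}).
        edge_integral e (\<lambda>_. 1) * edge_term (convex hull {p, a, b}) A S c e)) (at 0)"
proof -
  have "A + t *\<^sub>R S \<in> Sym" for t using A S by (simp add: pos_def_def Sym_iff)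
  then have "metric_angle (\<lambda>x. g x + t *\<^sub>R \<sigma> x) (convex hull {p, a, b}) p =
    arccos (((a - p) \<bullet> ((A + t *\<^sub>R S) *v (b - p))) /
      (sqrt ((a - p) \<bullet> ((A + t *\<^sub>R S) *v (a - p))) * sqrt ((b - p) \<bullet> ((A + t *\<^sub>R S) *v (b - p)))))" for t
    using g \<sigma> by (intro metric_angle_triangle[OF ccw]) auto
  moreover have "0 < cross2 (a - p) (b - p)" using ccw by (simp add: ccw_def)
  ultimately show ?thesis
    unfolding sum_edge_terms[OF ccw A S c] by (simp only: angle_derivative[OF A])
qed

theorem lemma3p3:
  fixes \<Omega> :: "(real^2) set" and \<T> :: "(real^2) set set"
    and y :: "nat \<Rightarrow> real^2" and N N\<^sub>0 i :: nat
    and \<phi> :: "nat \<Rightarrow> real^2 \<Rightarrow> real"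
    and g \<sigma> :: "real^2 \<Rightarrow> real^2^2"
  assumes "polygonal_domain \<Omega>"
    and "triangulation_of \<Omega> \<T>"
    and "bij_betw y {1..N} (vertices \<T>)"
    and "N\<^sub>0 < N"
    and "\<And>j. j \<in> {1..N} \<Longrightarrow> y j \<notin> frontier \<Omega> \<longleftrightarrow> j \<le> N\<^sub>0"
    and "\<And>j. j \<in> {1..N\<^sub>0} \<Longrightarrow> \<phi> j \<in> V_h 1 \<Omega> \<T>"
    and "\<And>j k. j \<in> {1..N\<^sub>0} \<Longrightarrow> k \<in> {1..N} \<Longrightarrow> \<phi> j (y k) = (if j = k then 1 else 0)"
    and "g \<in> Sigma_h_plus 0 \<Omega> \<T>"
    and "\<sigma> \<in> Sigma_h 0 \<Omega> \<T>"
    and "i \<in> {1..N\<^sub>0}"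
  shows "((\<lambda>t. 2 * pi - (\<Sum>K\<in>vertex_patch \<T> (y i). metric_angle (\<lambda>x. g x + t *\<^sub>R \<sigma> x) K (y i)))
           has_real_derivative (1 / 2 * b_h \<T> g \<sigma> (\<phi> i))) (at 0)"
proof -
  let ?p = "y i" and ?v = "\<phi> i"
  have fin: "finite \<T>" and spx: "\<And>K. K \<in> \<T> \<Longrightarrow> 2 simplex K"
    using assms(2) by (auto simp: triangulation_of_def triangulation_def)
  have gh: "g \<in> Sigma_h 0 \<Omega> \<T>" using assms(8) by (simp add: Sigma_h_plus_def)
  have "\<forall>K\<in>\<T>. \<exists>k c. \<forall>x\<in>K. ?v x = k + c \<bullet> x"
    using V_h_1_affine[OF assms(6)[OF assms(10)]] by metis
  then obtain k c where v: "\<And>K x. K \<in> \<T> \<Longrightarrow> x \<in> K \<Longrightarrow> ?v x = k K + c K \<bullet> x" by metis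
  have nodal: "?v q = (if q = ?p then 1 else 0)" if "K \<in> \<T>" "q extreme_point_of K" for K q
  proof -
    have "q \<in> vertices \<T>" using that by (auto simp: vertices_def)
    then obtain j where j: "j \<in> {1..N}" "q = y j"
      using bij_betw_imp_surj_on[OF assms(3)] by blast
    \<comment> \<open>With \<open>i\<close> among the indices of all vertices, injectivity of
      \<open>y\<close> identifies \<open>q = y i\<close> with \<open>j = i\<close>; boundary
      vertices are covered too.\<close>
    have "i \<in> {1..N}" using assms(4,10) by auto
    then have "q = ?p \<longleftrightarrow> i = j" using j inj_on_eq_iff[OF bij_betw_imp_inj_on[OF assms(3)]] by metis
    then show ?thesis using assms(7)[OF assms(10) j(1)] j(2) by simp
  qed
  have aff: "k K + c K \<bullet> q = (if q = ?p then 1 else 0)" if "K \<in> \<T>" "q extreme_point_of K" for K q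
    using v[OF that(1), of q] nodal[OF that] that(2) by (simp add: extreme_point_of_def)
  define F where "F K = (\<Sum>e | e edge_of K. edge_integral e (\<lambda>_. 1) *
      edge_term K (const_value K g) (const_value K \<sigma>) (c K) e)" for K
  have patch: "((\<lambda>t. metric_angle (\<lambda>x. g x + t *\<^sub>R \<sigma> x) K ?p) has_real_derivative - (1 / 2) * F K) (at 0)"
    if "K \<in> vertex_patch \<T> ?p" for K
  proof -
    have K: "K \<in> \<T>" "?p extreme_point_of K" using that by (auto simp: vertex_patch_def)
    then obtain a b where ab: "K = convex hull {?p, a, b}" "ccw ?p a b"
      using simplex_2_obtain_ccw[OF spx] by metis
    have ne: "interior K \<noteq> {}" using interior_triangle_nonempty ab by blast
    have ex: "?p extreme_point_of K" "a extreme_point_of K" "b extreme_point_of K"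
      using extreme_points_triangle[OF ab(2)] ab(1) by auto
    have "k K + c K \<bullet> ?p = 1" "k K + c K \<bullet> a = 0" "k K + c K \<bullet> b = 0"
      using aff[OF K(1) ex(1)] aff[OF K(1) ex(2)] aff[OF K(1) ex(3)] ccw_distinct[OF ab(2)] by auto
    then have "c K \<bullet> (a - ?p) = -1" "c K \<bullet> (b - ?p) = -1"
      by (simp_all add: inner_diff_right)
    moreover have "pos_def (const_value K g)"
      using assms(8) K(1) ne Sigma_h_0_const_value(1)[OF gh K(1) ne] unfolding Sigma_h_plus_def by force
    ultimately show ?thesis
      using metric_angle_derivative[OF ab(2), folded ab(1)] Sigma_h_0_const_value[OF gh K(1) ne]
        Sigma_h_0_const_value[OF assms(9) K(1) ne]
      unfolding F_def by blast
  qed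
  \<comment> \<open>An affine function that is zero at three noncollinear points has zero gradient,
    and every edge term is linear in the gradient.\<close>
  have off: "F K = 0" if "K \<in> \<T> - vertex_patch \<T> ?p" for K
  proof -
    have K: "K \<in> \<T>" "\<not> ?p extreme_point_of K" using that by (auto simp: vertex_patch_def)
    then obtain a b d where ab: "K = convex hull {a, b, d}" "ccw a b d"
      using simplex_2_obtain_ccw'[OF spx] by metis
    have ex: "a extreme_point_of K" "b extreme_point_of K" "d extreme_point_of K"
      using extreme_points_triangle[OF ab(2)] ab(1) by auto
    then have "k K + c K \<bullet> a = 0" "k K + c K \<bullet> b = 0" "k K + c K \<bullet> d = 0"
      using aff[OF K(1) ex(1)] aff[OF K(1) ex(2)] aff[OF K(1) ex(3)] K(2) by auto
    then have "c K \<bullet> (b - a) = 0" "c K \<bullet> (d - a) = 0" by (simp_all add: inner_diff_right)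
    then have *: "c K $ 1 * (b - a) $ 1 + c K $ 2 * (b - a) $ 2 = 0" "c K $ 1 * (d - a) $ 1 + c K $ 2 * (d - a) $ 2 = 0"
      by (simp_all only: inner_pt)
    have "cross2 (b - a) (d - a) * c K $ 1 = 0" "cross2 (b - a) (d - a) * c K $ 2 = 0"
      using * unfolding cross2_def by algebra+
    then have "c K = 0" using ab(2) by (simp add: pt_eq_iff ccw_def)
    then show ?thesis by (simp add: F_def edge_term_def)
  qed
  have "b_h \<T> g \<sigma> ?v = (\<Sum>K\<in>\<T>. F K)"
    unfolding F_def by (rule b_h_eq_sum_edge_terms[OF assms(1,2,8,9) v])
  also have "\<dots> = (\<Sum>K\<in>vertex_patch \<T> ?p. F K)"
    using off fin by (intro sum.mono_neutral_right) (auto simp: vertex_patch_def)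
  finally have b: "b_h \<T> g \<sigma> ?v = (\<Sum>K\<in>vertex_patch \<T> ?p. F K)" .
  \<comment> \<open>Each angle contributes minus half its local sum; the minus sign of the angle
    defect turns this into plus one half.\<close>
  have "((\<lambda>t. 2 * pi - (\<Sum>K\<in>vertex_patch \<T> ?p. metric_angle (\<lambda>x. g x + t *\<^sub>R \<sigma> x) K ?p))
      has_real_derivative 0 - (\<Sum>K\<in>vertex_patch \<T> ?p. - (1 / 2) * F K)) (at 0)"
    by (intro DERIV_diff DERIV_const DERIV_sum patch)
  also have "0 - (\<Sum>K\<in>vertex_patch \<T> ?p. - (1 / 2) * F K) = 1 / 2 * b_h \<T> g \<sigma> ?v"
    unfolding b by (simp add: sum_negf sum_divide_distrib)
  finally show ?thesis .
qed

end
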